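(* Let $z=(z_0,\dots,z_n)$ satisfy the model $$z_i-\mu_k^\star=\rho^\star(z_{i-1}-\mu_k^\star)+\epsilon_i,\qquad t_{n,k}^\star+1\le i\le t_{n,k+1}^\star,\ 0\le k\le m,$$ with the assumptions given in the context, and let $(\overline\rho_n)$ be a sequence of real-valued random variables with $\overline\rho_n-\rho^\star=O_P(n^{-1/2})$ as $n\to\infty$. Let $(\Delta_n)$ be a real sequence with $n^{-1}\Delta_n\to0$ and $n^{-\alpha}\Delta_n\to+\infty$ for some $\alpha>0$. Let $$\big(\widehat{\boldsymbol\delta}_n(z,\overline\rho_n),\widehat{\boldsymbol t}_n(z,\overline\rho_n)\big)=\operatorname*{arg\,min}_{(\boldsymbol\delta,\boldsymbol t)\in\mathbb{R}^{m+1}\times\mathcal{A}_{n,m}}SS_m(z,\overline\rho_n,\boldsymbol\delta,\boldsymbol t),\qquad \widehat{\boldsymbol\tau}_n(z,\overline\rho_n)=\tfrac1n\widehat{\boldsymbol t}_n(z,\overline\rho_n).$$ Then, as $n\to\infty$, $$\|\widehat{\boldsymbol\tau}_n(z,\overline\rho_n)-\boldsymbol\tau^\star\|=O_P(n^{-1}),\qquad \|\widehat{\boldsymbol\delta}_n(z,\overline\rho_n)-\boldsymbol\delta^\star\|=O_P(n^{-1/2}),$$ where $\|\cdot\|$ is the Euclidean norm. This holds when the $\epsilon_i$ are i.i.d. zero-mean Gaussian, and still holds if the (i.i.d.) $\epsilon_i$ are only assumed to be centered with a finite second-order moment.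
   Context: Parameters. $m$ is the known true number of change-points; $0=\tau_0^\star<\tau_1^\star<\dots<\tau_{m+1}^\star=1$, $\boldsymbol\tau^\star=(\tau_k^\star)_{0\le k\le m+1}$, $t_{n,k}^\star=\lfloor n\tau_k^\star\rfloor$; $\mu_0^\star,\dots,\mu_m^\star\in\mathbb{R}$ with $\mu_k^\star\ne\mu_{k-1}^\star$ for $1\le k\le m$; $|\rho^\star|<1$; $\sigma^\star>0$; $\boldsymbol\delta^\star=(\delta_k^\star)_{0\le k\le m}$ with $\delta_k^\star=(1-\rho^\star)\mu_k^\star$. These do not depend on $n$. Noise. $(\epsilon_i)_{i\ge1}$ are i.i.d., zero-mean with variance $\sigma^{\star2}$; $z_0$ is independent of $(\epsilon_i)_{i\ge1}$, with mean $\mu_0^\star$ and variance $\sigma^{\star2}/(1-\rho^{\star2})$, with law not depending on $n$. In the Gaussian case $z_0$ and the $\epsilon_i$ are Gaussian. Admissible segmentations: $\mathcal{A}_{n,m}=\{(t_0,\dots,t_{m+1}) \text{ integers}: t_0=0<t_1<\dots<t_{m+1}=n,\ t_k-t_{k-1}\ge\Delta_n\ \forall k=1,\dots,m+1\}$. Criterion: for $x=(x_0,\dots,x_n)$, $\rho\in\mathbb{R}$, $\boldsymbol\delta=(\delta_0,\dots,\delta_m)\in\mathbb{R}^{m+1}$, $\boldsymbol t\in\mathcal A_{n,m}$, $$SS_m(x,\rho,\boldsymbol\delta,\boldsymbol t)=\sum_{k=0}^m\sum_{i=t_k+1}^{t_{k+1}}(x_i-\rho x_{i-1}-\delta_k)^2.$$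 The $\arg\min$ denotes any (measurable) choice of minimizer, defined for $n$ large enough that $\mathcal A_{n,m}\neq\emptyset$. *)

theory Defs
  imports "HOL-Probability.Probability"
begin

text \<open>
  Stochastic boundedness \<open>X\<^sub>n = O\<^sub>P(a\<^sub>n)\<close>. It is meant for random variables \<open>X n\<close> only, since
  \<open>prob\<close> is 0 on non-measurable sets.
\<close>

definition (in prob_space) big_OP :: "(nat \<Rightarrow> 'a \<Rightarrow> real) \<Rightarrow> (nat \<Rightarrow> real) \<Rightarrow> bool" where
  "big_OP X a \<longleftrightarrow>
     (\<forall>e>0. \<exists>C>0. \<forall>\<^sub>F n in sequentially. prob {\<omega> \<in> space M. \<bar>X n \<omega>\<bar> > C * a n} < e)"

definition (in prob_space) has_mean_variance :: "('a \<Rightarrow> real) \<Rightarrow> real \<Rightarrow> real \<Rightarrow> bool" where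
  "has_mean_variance X c v \<longleftrightarrow>
     random_variable borel X \<and> integrable M X \<and> integrable M (\<lambda>\<omega>. (X \<omega>)\<^sup>2) \<and>
     expectation X = c \<and> variance X = v"

definition (in prob_space) iid_mean_variance ::
    "(nat \<Rightarrow> 'a \<Rightarrow> real) \<Rightarrow> nat set \<Rightarrow> real \<Rightarrow> real \<Rightarrow> bool" where
  "iid_mean_variance X I c v \<longleftrightarrow>
     indep_vars (\<lambda>_. borel) X I \<and>
     (\<forall>i\<in>I. \<forall>j\<in>I. distr M borel (X i) = distr M borel (X j)) \<and>
     (\<forall>i\<in>I. has_mean_variance (X i) c v)"

text \<open>The library's \<open>indep_var\<close> requires both variables to have values in the same type.\<close>

definition (in prob_space) indep_rv ::
    "'b measure \<Rightarrow> ('a \<Rightarrow> 'b) \<Rightarrow> 'c measure \<Rightarrow> ('a \<Rightarrow> 'c) \<Rightarrow> bool" where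
  "indep_rv N X N' Y \<longleftrightarrow>
     random_variable N X \<and> random_variable N' Y \<and>
     indep_set {X -` A \<inter> space M |A. A \<in> sets N} {Y -` B \<inter> space M |B. B \<in> sets N'}"

text \<open>
  The finite vectors \<open>(\<delta>\<^sub>0, \<dots>, \<delta>\<^sub>m)\<close> and \<open>(t\<^sub>0, \<dots>, t\<^sub>m\<^sub>+\<^sub>1)\<close> are represented by functions on
  \<^typ>\<open>nat\<close> whose values beyond the last index are unconstrained and never used.
\<close>

definition admissible :: "(nat \<Rightarrow> real) \<Rightarrow> nat \<Rightarrow> nat \<Rightarrow> (nat \<Rightarrow> nat) set" where
  "admissible \<Delta> n m =
     {t. t 0 = 0 \<and> t (m + 1) = n \<and>
         (\<forall>k\<in>{1..m + 1}. t (k - 1) < t k \<and> real (t k) - real (t (k - 1)) \<ge> \<Delta> n)}"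

definition SS ::
    "nat \<Rightarrow> (nat \<Rightarrow> real) \<Rightarrow> real \<Rightarrow> (nat \<Rightarrow> real) \<Rightarrow> (nat \<Rightarrow> nat) \<Rightarrow> real" where
  "SS m x \<rho> \<delta> t = (\<Sum>k=0..m. \<Sum>i=t k + 1..t (k + 1). (x i - \<rho> * x (i - 1) - \<delta> k)\<^sup>2)"

definition change_index :: "(nat \<Rightarrow> real) \<Rightarrow> nat \<Rightarrow> nat \<Rightarrow> nat" where
  "change_index \<tau> n k = nat \<lfloor>real n * \<tau> k\<rfloor>"

end

theory Submission imports Defs begin

text \<open>
  Put \<open>y\<^sub>i = z\<^sub>i - \<rho>bar z\<^sub>i\<^sub>-\<^sub>1\<close>. Along the true segmentation \<open>y\<^sub>i = \<delta>\<^sub>k + e\<^sub>i\<close> with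
  \<open>e\<^sub>i = \<epsilon>\<^sub>i + r z\<^sub>i\<^sub>-\<^sub>1\<close>, \<open>r = \<rho> - \<rho>bar = O\<^sub>P(1 / sqrt n)\<close>, and the criterion is the residual sum of squares of a
  step function fitted to \<open>y\<close>. The proof separates what is deterministic about such a fit from the few
  probabilistic facts about the partial sums of \<open>e\<close>.

  \<^bold>\<open>Consistency.\<close> Suppose that the partial sums of \<open>e\<close> are at most \<open>R\<close>. Since the fit is at least as good as
  the true step function, the squared \<open>L\<^sup>2\<close> distance \<open>G\<^sup>2\<close> between the two is at most twice the correlation
  of their difference with \<open>e\<close>, and a step function with bounded levels has correlation \<open>O(R)\<close> with \<open>e\<close>. The fitted
  levels are bounded by a constant plus \<open>G / sqrt \<Delta>\<^sub>n\<close>, because every fitted segment has length at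
  least \<open>\<Delta>\<^sub>n\<close>. Hence \<open>G\<^sup>2 = O(R + R\<^sup>2 / \<Delta>\<^sub>n)\<close> (\<open>risk_bound\<close>), which is \<open>o(n)\<close> for
  \<open>R = O(sqrt n)\<close> as \<open>\<Delta>\<^sub>n\<close> tends to infinity. A change-point at distance \<open>w\<close> from all the
  fitted ones costs at least a constant times \<open>w\<close> (\<open>risk_of_missed_change\<close>), so the fitted change-points are
  within \<open>o(n)\<close> of the true ones and the fitted levels are close to the true levels.

  \<^bold>\<open>Rates.\<close> Moving a single fitted change-point to its true position, without changing any level, cannot
  improve the fit. On the \<open>L\<close> indices between the two positions the gain would be of order \<open>L\<close>,
  unless the noise summed over them is of order \<open>L\<close> too. So if the sums of \<open>e\<close> over intervals of length
  \<open>L \<ge> L\<^sub>0\<close> that start or end at a true change-point are at most a small multiple of \<open>L\<close>, the error is less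
  than \<open>L\<^sub>0\<close> (\<open>change_point_rate\<close>). Each fitted segment then differs from the true one by a bounded
  number of indices, and comparing the fitted level with the true level gives an error \<open>O(R / n)\<close>
  (\<open>level_rate\<close>).

  \<^bold>\<open>Noise.\<close> Summing the autoregression expresses the sum of \<open>r z\<^sub>i\<^sub>-\<^sub>1\<close> over an interval by the sum of the
  \<open>\<epsilon>\<^sub>i\<close>, the length of the interval and the values of \<open>z\<close> at its ends (\<open>perturbed_noise_sum\<close>). As the \<open>\<epsilon>\<^sub>i\<close> are
  increments of their partial sums, bounds for those also give \<open>z = O(sqrt n)\<close>, whence \<open>r z = O(1)\<close>. Everything
  is thus reduced to the partial sums of \<open>\<epsilon>\<close>, globally of order \<open>sqrt n\<close> and locally at most \<open>\<eta> L\<close> for all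
  \<open>L \<ge> L\<^sub>0\<close>. Both follow from Kolmogorov's maximal inequality (\<open>kolmogorov_maximal_inequality\<close>), the local one
  by applying it to dyadic blocks, whose exceptional probabilities are summable (\<open>sums_near_anchors\<close>).
\<close>

section \<open>Segmentations and residual sums of squares\<close>

definition segmentation :: "nat \<Rightarrow> nat \<Rightarrow> (nat \<Rightarrow> nat) \<Rightarrow> bool" where
  "segmentation m n t \<longleftrightarrow> t 0 = 0 \<and> t (m + 1) = n \<and> (\<forall>k\<le>m. t k < t (k + 1))"

text \<open>
  The index of the segment that contains \<open>i\<close>. Counting the change-points to the left of \<open>i\<close> makes it evident
  that moving one of them alters the index only at the positions in between.
\<close>
definition seg :: "nat \<Rightarrow> (nat \<Rightarrow> nat) \<Rightarrow> nat \<Rightarrow> nat" where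
  "seg m t i = card {k \<in> {1..m}. t k < i}"

lemma seg_le: "seg m t i \<le> m"
  unfolding seg_def by (rule order_trans[OF card_mono[of "{1..m}"]]) auto

lemma segmentation_mono:
  assumes "segmentation m n t" "j \<le> k" "k \<le> m + 1"
  shows "t j \<le> t k"
  using assms(2,3)
proof (induction k rule: dec_induct)
  case (step k)
  then show ?case using assms(1) unfolding segmentation_def
    by (metis Suc_eq_plus1 Suc_le_mono le_trans less_imp_le nat_le_linear not_less_eq_eq)
qed simp

lemma segmentation_le: "segmentation m n t \<Longrightarrow> k \<le> m + 1 \<Longrightarrow> t k \<le> n"
  using segmentation_mono[of m n t k "m + 1"] by (auto simp: segmentation_def)

lemma seg_eq:
  assumes t: "segmentation m n t" and k: "k \<le> m" and i: "t k < i" "i \<le> t (k + 1)"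
  shows "seg m t i = k"
proof -
  have "t j < i \<longleftrightarrow> j \<le> k" if "j \<le> m" for j
    using segmentation_mono[OF t, of j k] segmentation_mono[OF t, of "k + 1" j] that k i
    by (cases "j \<le> k") auto
  then have "{j \<in> {1..m}. t j < i} = {1..k}"
    using k by auto
  then show ?thesis by (simp add: seg_def)
qed

lemma seg_bounds:
  assumes t: "segmentation m n t" and i: "1 \<le> i" "i \<le> n"
  shows "t (seg m t i) < i" "i \<le> t (seg m t i + 1)"
proof -
  define k where "k = (LEAST k. i \<le> t (k + 1))"
  have m: "i \<le> t (m + 1)" using t i by (simp add: segmentation_def)
  have k1: "i \<le> t (k + 1)" unfolding k_def by (rule LeastI[of _ m]) (rule m)
  have k2: "k \<le> m" unfolding k_def by (rule Least_le) (rule m)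
  have "t k < i"
  proof (cases k)
    case 0
    then show ?thesis using t i by (simp add: segmentation_def)
  next
    case (Suc l)
    then show ?thesis using not_less_Least[of l "\<lambda>k. i \<le> t (k + 1)"] k_def by simp
  qed
  then have "seg m t i = k" using seg_eq[OF t k2 _ k1] by simp
  with \<open>t k < i\<close> k1 show "t (seg m t i) < i" "i \<le> t (seg m t i + 1)" by auto
qed

text \<open>
  Turns the double sum of the criterion into a sum over one index set that does not depend on the segmentation,
  so that two segmentations can be compared index by index.
\<close>
lemma sum_over_segments:
  fixes g :: "nat \<Rightarrow> nat \<Rightarrow> real"
  assumes t: "segmentation m n t"
  shows "(\<Sum>k=0..m. \<Sum>i=t k + 1..t (k + 1). g k i) = (\<Sum>i=1..n. g (seg m t i) i)"
proof -
  have *: "{t k + 1..t (k + 1)} = {i \<in> {1..n}. seg m t i = k}" if "k \<in> {0..m}" for k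
  proof (intro equalityI subsetI)
    fix i assume i: "i \<in> {t k + 1..t (k + 1)}"
    then have "seg m t i = k" using that by (intro seg_eq[OF t]) auto
    then show "i \<in> {i \<in> {1..n}. seg m t i = k}"
      using i segmentation_le[OF t, of "k + 1"] that by simp
  next
    fix i assume "i \<in> {i \<in> {1..n}. seg m t i = k}"
    then show "i \<in> {t k + 1..t (k + 1)}"
      using seg_bounds[OF t, of i] by force
  qed
  have "(\<Sum>k=0..m. \<Sum>i=t k + 1..t (k + 1). g k i)
      = (\<Sum>k=0..m. \<Sum>i\<in>{i \<in> {1..n}. seg m t i = k}. g (seg m t i) i)"
    using * by (intro sum.cong) auto
  also have "\<dots> = (\<Sum>i=1..n. g (seg m t i) i)"
    by (rule sum.group) (auto simp: seg_le)
  finally show ?thesis .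
qed

definition rss :: "nat \<Rightarrow> (nat \<Rightarrow> real) \<Rightarrow> (nat \<Rightarrow> real) \<Rightarrow> (nat \<Rightarrow> nat) \<Rightarrow> real" where
  "rss m y d t = (\<Sum>k=0..m. \<Sum>i=t k + 1..t (k + 1). (y i - d k)\<^sup>2)"

lemma rss_eq: "segmentation m n t \<Longrightarrow> rss m y d t = (\<Sum>i=1..n. (y i - d (seg m t i))\<^sup>2)"
  unfolding rss_def by (rule sum_over_segments)

lemma sum_interval_diff:
  fixes e :: "nat \<Rightarrow> real"
  assumes "a \<le> b"
  shows "(\<Sum>i=a + 1..b. e i) = (\<Sum>i=1..b. e i) - (\<Sum>i=1..a. e i)"
proof -
  have "{1..b} = {1..a} \<union> {a + 1..b}" using assms by auto
  then have "(\<Sum>i=1..b. e i) = (\<Sum>i=1..a. e i) + (\<Sum>i=a + 1..b. e i)"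
    by (simp add: sum.union_disjoint)
  then show ?thesis by simp
qed

lemma admissible_iff:
  "t \<in> admissible \<Delta> n m \<longleftrightarrow> segmentation m n t \<and> (\<forall>k\<le>m. \<Delta> n \<le> real (t (k + 1)) - real (t k))"
proof -
  have "(\<forall>k\<in>{1..m + 1}. P (k - 1) k) \<longleftrightarrow> (\<forall>k\<le>m. P k (k + 1))" for P :: "nat \<Rightarrow> nat \<Rightarrow> bool"
  proof
    assume "\<forall>k\<in>{1..m + 1}. P (k - 1) k"
    then show "\<forall>k\<le>m. P k (k + 1)" by force
  next
    assume "\<forall>k\<le>m. P k (k + 1)"
    then show "\<forall>k\<in>{1..m + 1}. P (k - 1) k"
      by (metis Suc_eq_plus1 Suc_le_mono Suc_pred atLeastAtMost_iff le_add_diff_inverse2 diff_le_mono add_diff_cancel_right')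
  qed
  from this[of "\<lambda>j k. t j < t k \<and> \<Delta> n \<le> real (t k) - real (t j)"] show ?thesis
    unfolding admissible_def segmentation_def by auto
qed

lemma SS_eq_rss: "SS m x \<rho> d t = rss m (\<lambda>i. x i - \<rho> * x (i - 1)) d t"
  by (simp add: SS_def rss_def)

section \<open>Fitting noisy step functions by least squares\<close>

text \<open>
  This matches change-points: once every true change-point has its own fitted one nearby, in increasing order, the
  \<open>k\<close>-th fitted one must be near the \<open>k\<close>-th true one.
\<close>
lemma strict_mono_self_map:
  fixes f :: "nat \<Rightarrow> nat"
  assumes range: "\<And>j. j \<in> {1..m} \<Longrightarrow> f j \<in> {1..m}"
    and mono: "\<And>i j. i \<in> {1..m} \<Longrightarrow> j \<in> {1..m} \<Longrightarrow> i < j \<Longrightarrow> f i < f j"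
    and j: "j \<in> {1..m}"
  shows "f j = j"
proof (rule antisym)
  have "1 \<le> j" using j by simp
  then show "j \<le> f j" using j
  proof (induction j rule: dec_induct)
    case base then show ?case using range by fastforce
  next
    case (step i) then show ?case using mono[of i "Suc i"] by auto
  qed
  have "j \<le> m" using j by simp
  then show "f j \<le> j" using j
  proof (induction j rule: inc_induct)
    case base then show ?case using range[of m] by simp
  next
    case (step i) then show ?case using mono[of i "Suc i"] by auto
  qed
qed

text \<open>
  On a set \<open>I\<close> of observations with level \<open>c\<close>, let \<open>p\<close> be a fitted value of that level and \<open>q\<close> one of
  another level \<open>c'\<close>. The difference of the two sums of squares is \<open>(p - q) ((2 c - p - q) card I + 2 E)\<close>, where \<open>E\<close> is
  the sum of the noise over \<open>I\<close>. So \<open>q\<close> can fit at least as well as \<open>p\<close> only if \<open>E\<close> outweighs the jump.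
\<close>
lemma level_comparison:
  fixes c c' p q \<kappa> :: real and e :: "nat \<Rightarrow> real"
  assumes le: "(\<Sum>i\<in>I. (c + e i - q)\<^sup>2) \<le> (\<Sum>i\<in>I. (c + e i - p)\<^sup>2)"
    and p: "\<bar>p - c\<bar> \<le> \<kappa>" and q: "\<bar>q - c'\<bar> \<le> \<kappa>" and sep: "2 * \<kappa> < \<bar>c - c'\<bar>"
  shows "(\<bar>c - c'\<bar> - 2 * \<kappa>) * real (card I) \<le> 2 * \<bar>\<Sum>i\<in>I. e i\<bar>"
proof -
  define E where "E = (\<Sum>i\<in>I. e i)"
  define L where "L = real (card I)"
  have "(c + e i - q)\<^sup>2 - (c + e i - p)\<^sup>2 = (p - q) * (2 * c - p - q) + (2 * (p - q)) * e i" for i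
    by (simp add: power2_eq_square algebra_simps)
  then have "(\<Sum>i\<in>I. (c + e i - q)\<^sup>2) - (\<Sum>i\<in>I. (c + e i - p)\<^sup>2)
      = (\<Sum>i\<in>I. (p - q) * (2 * c - p - q) + (2 * (p - q)) * e i)"
    by (simp add: sum_subtractf [symmetric])
  also have "\<dots> = (p - q) * ((2 * c - p - q) * L + 2 * E)"
    unfolding E_def L_def by (subst sum.distrib) (simp add: sum_distrib_left [symmetric] distrib_left)
  finally have neg: "(p - q) * ((2 * c - p - q) * L + 2 * E) \<le> 0" using le by simp
  have L: "0 \<le> L" by (simp add: L_def)
  have "(\<bar>c - c'\<bar> - 2 * \<kappa>) * L \<le> 2 * \<bar>E\<bar>"
  proof (cases "c > c'")
    case True
    then have "0 < p - q" using p q sep by linarith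
    then have "(2 * c - p - q) * L + 2 * E \<le> 0" using neg by (simp add: mult_le_0_iff)
    moreover have "(\<bar>c - c'\<bar> - 2 * \<kappa>) * L \<le> (2 * c - p - q) * L"
      using True p q by (intro mult_right_mono L) linarith
    ultimately show ?thesis by linarith
  next
    case False
    then have "p - q < 0" using p q sep by linarith
    then have "0 \<le> (2 * c - p - q) * L + 2 * E" using neg by (simp add: mult_le_0_iff)
    moreover have "(\<bar>c - c'\<bar> - 2 * \<kappa>) * L \<le> - (2 * c - p - q) * L"
      using False p q by (intro mult_right_mono L) linarith
    ultimately show ?thesis by (simp add: algebra_simps)
  qed
  then show ?thesis by (simp add: E_def L_def)
qed

text \<open>
  With \<open>Y\<close> the sum on the right, the difference of the two sums of squares is
  \<open>card I (d - c)\<^sup>2 - 2 (d - c) Y\<close>. This avoids computing the minimizing level.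
\<close>
lemma level_error:
  fixes c d :: real and y :: "nat \<Rightarrow> real"
  assumes "(\<Sum>i\<in>I. (y i - d)\<^sup>2) \<le> (\<Sum>i\<in>I. (y i - c)\<^sup>2)"
  shows "real (card I) * \<bar>d - c\<bar> \<le> 2 * \<bar>\<Sum>i\<in>I. (y i - c)\<bar>"
proof -
  define Y where "Y = (\<Sum>i\<in>I. (y i - c))"
  define L where "L = real (card I)"
  have "(y i - d)\<^sup>2 - (y i - c)\<^sup>2 = (d - c)\<^sup>2 - (2 * (d - c)) * (y i - c)" for i
    by (simp add: power2_eq_square algebra_simps)
  then have "(\<Sum>i\<in>I. (y i - d)\<^sup>2) - (\<Sum>i\<in>I. (y i - c)\<^sup>2)
      = (\<Sum>i\<in>I. (d - c)\<^sup>2 - (2 * (d - c)) * (y i - c))"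
    by (simp add: sum_subtractf [symmetric])
  also have "\<dots> = L * (d - c)\<^sup>2 - 2 * (d - c) * Y"
    unfolding Y_def L_def by (subst sum_subtractf) (simp add: sum_distrib_left [symmetric])
  finally have "L * (d - c)\<^sup>2 \<le> 2 * ((d - c) * Y)" using assms by (simp add: algebra_simps)
  also have "\<dots> \<le> 2 * (\<bar>d - c\<bar> * \<bar>Y\<bar>)"
    by (intro mult_left_mono) (simp_all flip: abs_mult)
  finally have "\<bar>d - c\<bar> * (L * \<bar>d - c\<bar>) \<le> \<bar>d - c\<bar> * (2 * \<bar>Y\<bar>)"
    by (simp add: power2_eq_square abs_mult_self_eq algebra_simps)
  then have "L * \<bar>d - c\<bar> \<le> 2 * \<bar>Y\<bar>"
    by (cases "d = c") auto
  then show ?thesis by (simp add: Y_def L_def)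
qed

locale noisy_steps =
  fixes m n :: nat and s :: "nat \<Rightarrow> nat" and \<delta> y e :: "nat \<Rightarrow> real"
  assumes s: "segmentation m n s"
    and y: "\<And>k i. k \<le> m \<Longrightarrow> s k < i \<Longrightarrow> i \<le> s (k + 1) \<Longrightarrow> y i = \<delta> k + e i"
begin

lemma y_eq: "i \<in> {1..n} \<Longrightarrow> y i = \<delta> (seg m s i) + e i"
  using y[OF seg_le] seg_bounds[OF s] by auto

text \<open>Squared \<open>L\<^sup>2\<close> distance on \<open>{1..n}\<close> between the step function \<open>(d, t)\<close> and the true one.\<close>
definition risk :: "(nat \<Rightarrow> real) \<Rightarrow> (nat \<Rightarrow> nat) \<Rightarrow> real" where
  "risk d t = (\<Sum>i=1..n. (d (seg m t i) - \<delta> (seg m s i))\<^sup>2)"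

lemma risk_ge: "I \<subseteq> {1..n} \<Longrightarrow> (\<Sum>i\<in>I. (d (seg m t i) - \<delta> (seg m s i))\<^sup>2) \<le> risk d t"
  unfolding risk_def by (intro sum_mono2) auto

lemma risk_nonneg: "0 \<le> risk d t"
  unfolding risk_def by (intro sum_nonneg) auto

lemma basic_inequality:
  assumes t: "segmentation m n t" and opt: "rss m y d t \<le> rss m y \<delta> s"
  shows "risk d t \<le> 2 * (\<Sum>i=1..n. e i * d (seg m t i)) - 2 * (\<Sum>i=1..n. e i * \<delta> (seg m s i))"
proof -
  have "(y i - d (seg m t i))\<^sup>2 - (y i - \<delta> (seg m s i))\<^sup>2
      = (d (seg m t i) - \<delta> (seg m s i))\<^sup>2 - (2 * (e i * d (seg m t i)) - 2 * (e i * \<delta> (seg m s i)))"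
    if "i \<in> {1..n}" for i
    using y_eq[OF that] by (simp add: power2_eq_square algebra_simps)
  then have "rss m y d t - rss m y \<delta> s
      = (\<Sum>i=1..n. (d (seg m t i) - \<delta> (seg m s i))\<^sup>2
          - (2 * (e i * d (seg m t i)) - 2 * (e i * \<delta> (seg m s i))))"
    unfolding rss_eq[OF t] rss_eq[OF s] sum_subtractf [symmetric] by (intro sum.cong) auto
  also have "\<dots> = risk d t
      - (2 * (\<Sum>i=1..n. e i * d (seg m t i)) - 2 * (\<Sum>i=1..n. e i * \<delta> (seg m s i)))"
    by (simp add: risk_def sum_subtractf sum_distrib_left)
  finally show ?thesis using opt by simp
qed

text \<open>Each of the \<open>m + 1\<close> segments contributes its level times a difference of two partial sums of the noise.\<close>
lemma noise_against_steps:
  assumes t: "segmentation m n t"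
    and R: "\<And>j. j \<le> n \<Longrightarrow> \<bar>\<Sum>i=1..j. e i\<bar> \<le> R"
    and d: "\<And>k. k \<le> m \<Longrightarrow> \<bar>d k\<bar> \<le> B"
  shows "\<bar>\<Sum>i=1..n. e i * d (seg m t i)\<bar> \<le> 2 * real (m + 1) * R * B"
proof -
  have "(\<Sum>i=1..n. e i * d (seg m t i)) = (\<Sum>k=0..m. \<Sum>i=t k + 1..t (k + 1). e i * d k)"
    using sum_over_segments[OF t, of "\<lambda>k i. e i * d k"] by simp
  also have "\<bar>\<dots>\<bar> \<le> (\<Sum>k=0..m. 2 * R * B)"
  proof (rule order_trans[OF sum_abs sum_mono])
    fix k assume k: "k \<in> {0..m}"
    have le: "t k \<le> t (k + 1)" "t (k + 1) \<le> n"
      using t k segmentation_le[OF t] by (auto simp: segmentation_def less_imp_le)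
    have "\<bar>\<Sum>i=t k + 1..t (k + 1). e i\<bar> \<le> 2 * R"
      using sum_interval_diff[OF le(1), of e] R[of "t k"] R[of "t (k + 1)"] le by linarith
    then have "\<bar>\<Sum>i=t k + 1..t (k + 1). e i\<bar> * \<bar>d k\<bar> \<le> 2 * R * B"
      using d k by (intro mult_mono) auto
    then show "\<bar>\<Sum>i=t k + 1..t (k + 1). e i * d k\<bar> \<le> 2 * R * B"
      by (simp add: sum_distrib_right [symmetric] abs_mult)
  qed
  also have "\<dots> = 2 * real (m + 1) * R * B" by simp
  finally show ?thesis .
qed

text \<open>
  The levels of the fit have no a priori bound. But a level exceeding \<open>D\<close> by \<open>h\<close> contributes \<open>\<Delta> h\<^sup>2\<close> to the risk
  \<open>G\<^sup>2\<close>, so levels are at most \<open>D + G / sqrt \<Delta>\<close>. Inserted into the basic inequality, this bounds \<open>G\<^sup>2\<close> by a linear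
  function of \<open>G\<close>, and the linear term is absorbed by the arithmetic-geometric mean inequality.
\<close>
lemma risk_bound:
  assumes t: "segmentation m n t" and opt: "rss m y d t \<le> rss m y \<delta> s"
    and gap: "\<And>k. k \<le> m \<Longrightarrow> real (t (k + 1)) - real (t k) \<ge> \<Delta>" and \<Delta>: "\<Delta> > 0"
    and D: "\<And>k. k \<le> m \<Longrightarrow> \<bar>\<delta> k\<bar> \<le> D"
    and R: "\<And>j. j \<le> n \<Longrightarrow> \<bar>\<Sum>i=1..j. e i\<bar> \<le> R"
  shows "risk d t \<le> 16 * real (m + 1) * R * D + 16 * (real (m + 1) * R)\<^sup>2 / \<Delta>"
proof -
  define G where "G = sqrt (risk d t)"
  have G: "0 \<le> G" "G\<^sup>2 = risk d t" using risk_nonneg by (auto simp: G_def)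
  have R0: "0 \<le> R" using R[of 0] by simp
  have d: "\<bar>d k\<bar> \<le> D + G / sqrt \<Delta>" if k: "k \<le> m" for k
  proof (cases "\<bar>d k\<bar> \<le> D")
    case True
    then show ?thesis using G \<Delta> by (smt (verit) divide_nonneg_nonneg real_sqrt_ge_zero)
  next
    case False
    let ?I = "{t k + 1..t (k + 1)}"
    have "\<Delta> * (\<bar>d k\<bar> - D)\<^sup>2 \<le> real (card ?I) * (\<bar>d k\<bar> - D)\<^sup>2"
      using gap[OF k] by (intro mult_right_mono) auto
    also have "\<dots> = (\<Sum>i\<in>?I. (\<bar>d k\<bar> - D)\<^sup>2)" by simp
    also have "\<dots> \<le> (\<Sum>i\<in>?I. (d (seg m t i) - \<delta> (seg m s i))\<^sup>2)"
    proof (rule sum_mono)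
      fix i assume "i \<in> ?I"
      then have "seg m t i = k" using k by (intro seg_eq[OF t]) auto
      moreover have "\<bar>d k\<bar> - D \<le> \<bar>d k - \<delta> (seg m s i)\<bar>"
        using D[OF seg_le[of m s i]] by linarith
      ultimately show "(\<bar>d k\<bar> - D)\<^sup>2 \<le> (d (seg m t i) - \<delta> (seg m s i))\<^sup>2"
        using False power_mono[of "\<bar>d k\<bar> - D" "\<bar>d k - \<delta> (seg m s i)\<bar>" 2] by simp
    qed
    also have "\<dots> \<le> G\<^sup>2"
      unfolding G(2) using segmentation_le[OF t, of "k + 1"] k by (intro risk_ge) auto
    finally have "(sqrt \<Delta> * (\<bar>d k\<bar> - D))\<^sup>2 \<le> G\<^sup>2"
      using \<Delta> by (simp add: power_mult_distrib)
    then have "sqrt \<Delta> * (\<bar>d k\<bar> - D) \<le> G" using G(1) by (rule power2_le_imp_le)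
    then show ?thesis using \<Delta> by (simp add: field_simps)
  qed
  define K where "K = 4 * real (m + 1) * R"
  have K: "0 \<le> K" using R0 by (simp add: K_def)
  have "\<bar>\<Sum>i=1..n. e i * d (seg m t i)\<bar> \<le> 2 * real (m + 1) * R * (D + G / sqrt \<Delta>)"
    by (rule noise_against_steps[OF t R d])
  moreover have "\<bar>\<Sum>i=1..n. e i * \<delta> (seg m s i)\<bar> \<le> 2 * real (m + 1) * R * D"
    by (rule noise_against_steps[OF s R D])
  ultimately have "G\<^sup>2 \<le> K * (D + G / sqrt \<Delta>) + K * D"
    using basic_inequality[OF t opt] unfolding G(2) K_def by linarith
  also have "\<dots> = 2 * K * D + G * (K / sqrt \<Delta>)" by (simp add: algebra_simps)
  also have "\<dots> \<le> 2 * K * D + (G\<^sup>2 + (K / sqrt \<Delta>)\<^sup>2) / 2"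
    using sum_squares_bound[of G "K / sqrt \<Delta>"] by (simp add: algebra_simps)
  finally have "G\<^sup>2 \<le> 4 * K * D + (K / sqrt \<Delta>)\<^sup>2" by (simp add: field_simps)
  moreover have "4 * K * D = 16 * real (m + 1) * R * D" by (simp add: K_def)
  moreover have "(K / sqrt \<Delta>)\<^sup>2 = 16 * (real (m + 1) * R)\<^sup>2 / \<Delta>"
    unfolding K_def using \<Delta> by (simp only: power_divide power_mult_distrib mult.assoc) simp
  ultimately show ?thesis using G(2) by simp
qed

text \<open>
  The fit is constant within distance \<open>w\<close> of the missed change-point, whereas the truth jumps there; pairing the
  \<open>w\<close> indices on the left with the \<open>w\<close> on the right, any constant \<open>c\<close> pays at least half the squared jump per pair.
\<close>
lemma risk_of_missed_change:
  assumes j: "j \<in> {1..m}" and w: "s (j - 1) + w \<le> s j" "s j + w \<le> s (j + 1)"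
    and miss: "\<And>k. k \<in> {1..m} \<Longrightarrow> t k + w \<le> s j \<or> s j + w \<le> t k"
  shows "real w * (\<delta> j - \<delta> (j - 1))\<^sup>2 \<le> 2 * risk d t"
proof -
  define c where "c = d (seg m t (s j))"
  have t_const: "d (seg m t i) = c" if "s j - w < i" "i \<le> s j + w" for i
  proof -
    have "{k \<in> {1..m}. t k < i} = {k \<in> {1..m}. t k < s j}"
      using miss that w by (cases "w = 0") (auto, force+)
    then show ?thesis by (simp add: c_def seg_def)
  qed
  have n: "s j + w \<le> n" using w(2) segmentation_le[OF s, of "j + 1"] j by simp
  have left: "seg m s i = j - 1" if "s j - w < i" "i \<le> s j" for i
    using that w j by (intro seg_eq[OF s]) auto
  have right: "seg m s i = j" if "s j < i" "i \<le> s j + w" for i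
    using that w j by (intro seg_eq[OF s]) auto
  let ?A = "{s j - w + 1..s j}" and ?B = "{s j + 1..s j + w}"
  have "real w * (\<delta> j - \<delta> (j - 1))\<^sup>2 \<le> real w * (2 * (c - \<delta> (j - 1))\<^sup>2 + 2 * (c - \<delta> j)\<^sup>2)"
  proof (rule mult_left_mono)
    have "(a - b)\<^sup>2 \<le> 2 * (c - b)\<^sup>2 + 2 * (c - a)\<^sup>2" for a b :: real
      using zero_le_power2[of "2 * c - a - b"] by (simp add: power2_eq_square algebra_simps)
    then show "(\<delta> j - \<delta> (j - 1))\<^sup>2 \<le> 2 * (c - \<delta> (j - 1))\<^sup>2 + 2 * (c - \<delta> j)\<^sup>2" .
  qed simp
  also have "\<dots> = 2 * ((\<Sum>i\<in>?A. (c - \<delta> (j - 1))\<^sup>2) + (\<Sum>i\<in>?B. (c - \<delta> j)\<^sup>2))"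
    using w by (simp add: algebra_simps of_nat_diff)
  also have "\<dots> = 2 * ((\<Sum>i\<in>?A. (d (seg m t i) - \<delta> (seg m s i))\<^sup>2) + (\<Sum>i\<in>?B. (d (seg m t i) - \<delta> (seg m s i))\<^sup>2))"
    using left right t_const by (intro arg_cong[where f = "(*) 2"] arg_cong2[where f = "(+)"] sum.cong) auto
  also have "\<dots> = 2 * (\<Sum>i\<in>?A \<union> ?B. (d (seg m t i) - \<delta> (seg m s i))\<^sup>2)"
    by (subst sum.union_disjoint) auto
  also have "\<dots> \<le> 2 * risk d t"
    using n by (intro mult_left_mono risk_ge) auto
  finally show ?thesis .
qed

text \<open>
  By \<open>risk_of_missed_change\<close> every true change-point has a fitted one within \<open>w\<close>. The neighbourhoods are disjoint, so
  this assignment is increasing and hence the identity.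
\<close>
lemma consistency:
  assumes t: "segmentation m n t"
    and J: "\<And>k. k \<in> {1..m} \<Longrightarrow> J \<le> \<bar>\<delta> k - \<delta> (k - 1)\<bar>" "J > 0"
    and gap: "\<And>k. k \<le> m \<Longrightarrow> s k + 2 * w \<le> s (k + 1)"
    and small: "2 * risk d t < real w * J\<^sup>2"
    and k: "k \<le> m + 1"
  shows "t k < s k + w \<and> s k < t k + w"
proof -
  have w: "w > 0" using small risk_nonneg[of d t] by (cases "w = 0") auto
  have "\<exists>k\<in>{1..m}. t k < s j + w \<and> s j < t k + w" if j: "j \<in> {1..m}" for j
  proof (rule ccontr)
    assume "\<not> ?thesis"
    then have miss: "t k + w \<le> s j \<or> s j + w \<le> t k" if "k \<in> {1..m}" for k
      using that by force
    have "real w * J\<^sup>2 \<le> real w * (\<delta> j - \<delta> (j - 1))\<^sup>2"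
      using J(1)[OF j] J(2) power_mono[of J "\<bar>\<delta> j - \<delta> (j - 1)\<bar>" 2]
      by (intro mult_left_mono) auto
    also have "\<dots> \<le> 2 * risk d t"
    proof (rule risk_of_missed_change[OF j _ _ miss])
      have "j - 1 \<le> m" "j - 1 + 1 = j" using j by auto
      then show "s (j - 1) + w \<le> s j" using gap[of "j - 1"] by simp
      show "s j + w \<le> s (j + 1)" using gap[of j] j by simp
    qed
    finally show False using small by simp
  qed
  then obtain f where f: "f j \<in> {1..m}" "t (f j) < s j + w" "s j < t (f j) + w"
    if "j \<in> {1..m}" for j
    by metis
  have mono: "f i < f j" if "i \<in> {1..m}" "j \<in> {1..m}" "i < j" for i j
  proof (rule ccontr)
    assume "\<not> f i < f j"
    then have "t (f j) \<le> t (f i)"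
      using f(1)[OF that(1)] by (intro segmentation_mono[OF t]) auto
    moreover have "s i + 2 * w \<le> s j"
      using gap[of i] segmentation_mono[OF s, of "i + 1" j] that by auto
    ultimately show False using f(2)[OF that(1)] f(3)[OF that(2)] by linarith
  qed
  show ?thesis
  proof (cases "k \<in> {1..m}")
    case True
    have "f k = k" by (rule strict_mono_self_map[OF f(1) mono True])
    then show ?thesis using f[OF True] by simp
  next
    case False
    then have "k = 0 \<or> k = m + 1" using k by auto
    then show ?thesis using s t w by (auto simp: segmentation_def)
  qed
qed

text \<open>
  In the core of each true segment, of length at least \<open>w\<close>, the fit has level \<open>d k\<close> and the truth \<open>\<delta> k\<close>.
\<close>
lemma level_consistency:
  assumes t: "segmentation m n t"
    and near: "\<And>k. k \<le> m + 1 \<Longrightarrow> t k \<le> s k + w \<and> s k \<le> t k + w"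
    and gap: "\<And>k. k \<le> m \<Longrightarrow> s k + 3 * w \<le> s (k + 1)"
    and small: "risk d t \<le> real w * \<kappa>\<^sup>2" and \<kappa>: "0 \<le> \<kappa>" and w: "w > 0"
    and k: "k \<le> m"
  shows "\<bar>d k - \<delta> k\<bar> \<le> \<kappa>"
proof -
  let ?I = "{s k + w + 1..s (k + 1) - w}"
  have "real w * (d k - \<delta> k)\<^sup>2 \<le> real (card ?I) * (d k - \<delta> k)\<^sup>2"
    using gap[OF k] by (intro mult_right_mono) auto
  also have "\<dots> = (\<Sum>i\<in>?I. (d k - \<delta> k)\<^sup>2)" by simp
  also have "\<dots> = (\<Sum>i\<in>?I. (d (seg m t i) - \<delta> (seg m s i))\<^sup>2)"
  proof (rule sum.cong)
    fix i assume i: "i \<in> ?I"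
    have "seg m t i = k" using i near[of k] near[of "k + 1"] k by (intro seg_eq[OF t]) auto
    moreover have "seg m s i = k" using i k by (intro seg_eq[OF s]) auto
    ultimately show "(d k - \<delta> k)\<^sup>2 = (d (seg m t i) - \<delta> (seg m s i))\<^sup>2" by simp
  qed simp
  also have "\<dots> \<le> risk d t"
    using segmentation_le[OF s, of "k + 1"] k by (intro risk_ge) auto
  also note small
  finally have "(d k - \<delta> k)\<^sup>2 \<le> \<kappa>\<^sup>2" using w by simp
  then show ?thesis using \<kappa> by (simp add: abs_le_square_iff [symmetric])
qed

text \<open>
  The competitor has the fitted levels and the true position \<open>s j\<close>. It differs from the fit only between \<open>s j\<close> and
  \<open>t j\<close>, where the fit uses the level of the wrong side; \<open>level_comparison\<close> then shows that the noise over these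
  indices exceeds \<open>\<eta>\<close> times their number.
\<close>
lemma change_point_rate:
  assumes t: "segmentation m n t" and j: "j \<in> {1..m}"
    and opt: "rss m y d t \<le> rss m y d (t(j := s j))"
    and near: "s (j - 1) \<le> t j" "t j \<le> s (j + 1)" "t (j - 1) < s j" "s j < t (j + 1)"
    and d: "\<bar>d (j - 1) - \<delta> (j - 1)\<bar> \<le> \<kappa>" "\<bar>d j - \<delta> j\<bar> \<le> \<kappa>"
    and sep: "2 * \<kappa> + 2 * \<eta> < \<bar>\<delta> j - \<delta> (j - 1)\<bar>" and \<eta>: "0 \<le> \<eta>"
    and right: "\<And>L. L0 \<le> L \<Longrightarrow> s j + L \<le> n \<Longrightarrow> \<bar>\<Sum>i=s j + 1..s j + L. e i\<bar> \<le> \<eta> * real L"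
    and left: "\<And>L. L0 \<le> L \<Longrightarrow> L \<le> s j \<Longrightarrow> \<bar>\<Sum>i=s j - L + 1..s j. e i\<bar> \<le> \<eta> * real L"
    and L0: "L0 > 0"
  shows "t j < s j + L0 \<and> s j < t j + L0"
proof -
  define t' where "t' = t(j := s j)"
  have t': "segmentation m n t'"
    using t near j unfolding segmentation_def t'_def
    by (auto simp: fun_upd_def)
  define g where "g i k = (y i - d k)\<^sup>2" for i k
  have diff: "(\<Sum>i\<in>I. g i (seg m t i)) \<le> (\<Sum>i\<in>I. g i (seg m t' i))"
    if I: "I \<subseteq> {1..n}" and out: "\<And>i. i \<in> {1..n} - I \<Longrightarrow> t j < i \<longleftrightarrow> s j < i" for I
  proof -
    have "seg m t i = seg m t' i" if "i \<in> {1..n} - I" for i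
      unfolding seg_def t'_def using out[OF that] by (intro arg_cong[where f = card]) auto
    then have eq: "(\<Sum>i\<in>{1..n} - I. g i (seg m t i)) = (\<Sum>i\<in>{1..n} - I. g i (seg m t' i))"
      by (intro sum.cong) auto
    have "(\<Sum>i\<in>{1..n}. g i (seg m t i)) \<le> (\<Sum>i\<in>{1..n}. g i (seg m t' i))"
      using opt rss_eq[OF t] rss_eq[OF t'] by (simp add: g_def t'_def)
    then show ?thesis
      using eq sum.subset_diff[OF I, of "\<lambda>i. g i (seg m t i)"]
        sum.subset_diff[OF I, of "\<lambda>i. g i (seg m t' i)"] by simp
  qed
  have mono_t: "t (j - 1) < t j" "t j < t (j + 1)"
    using t j by (cases j; auto simp: segmentation_def)+
  have s_le: "s j \<le> n" "t j \<le> n" using segmentation_le[OF s] segmentation_le[OF t] j by auto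
  show ?thesis
  proof (rule ccontr)
    assume "\<not> ?thesis"
    then consider "s j + L0 \<le> t j" | "t j + L0 \<le> s j" by linarith
    then show False
    proof cases
      case 1
      let ?I = "{s j + 1..t j}"
      have "(\<Sum>i\<in>?I. (\<delta> j + e i - d (j - 1))\<^sup>2) = (\<Sum>i\<in>?I. g i (seg m t i))"
      proof (rule sum.cong)
        fix i assume i: "i \<in> ?I"
        have "seg m t i = j - 1" using i near j by (intro seg_eq[OF t]) auto
        moreover have "y i = \<delta> j + e i" using i near j by (intro y) auto
        ultimately show "(\<delta> j + e i - d (j - 1))\<^sup>2 = g i (seg m t i)" by (simp add: g_def)
      qed simp
      also have "\<dots> \<le> (\<Sum>i\<in>?I. g i (seg m t' i))" using 1 s_le by (intro diff) auto
      also have "\<dots> = (\<Sum>i\<in>?I. (\<delta> j + e i - d j)\<^sup>2)"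
      proof (rule sum.cong)
        fix i assume i: "i \<in> ?I"
        have "seg m t' i = j" using mono_t i near j by (intro seg_eq[OF t']) (auto simp: t'_def)
        moreover have "y i = \<delta> j + e i" using i near j by (intro y) auto
        ultimately show "g i (seg m t' i) = (\<delta> j + e i - d j)\<^sup>2" by (simp add: g_def)
      qed simp
      finally have "(\<bar>\<delta> j - \<delta> (j - 1)\<bar> - 2 * \<kappa>) * real (card ?I) \<le> 2 * \<bar>\<Sum>i\<in>?I. e i\<bar>"
        using d sep \<eta> by (intro level_comparison) auto
      also have "\<bar>\<Sum>i\<in>?I. e i\<bar> \<le> \<eta> * real (card ?I)"
        using right[of "t j - s j"] 1 s_le by simp
      finally have "(\<bar>\<delta> j - \<delta> (j - 1)\<bar> - 2 * \<kappa> - 2 * \<eta>) * real (card ?I) \<le> 0"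
        by (simp add: algebra_simps)
      moreover have "real (card ?I) > 0" using 1 L0 by simp
      ultimately show False using sep by (simp add: mult_le_0_iff)
    next
      case 2
      let ?I = "{t j + 1..s j}"
      have "(\<Sum>i\<in>?I. (\<delta> (j - 1) + e i - d j)\<^sup>2) = (\<Sum>i\<in>?I. g i (seg m t i))"
      proof (rule sum.cong)
        fix i assume i: "i \<in> ?I"
        have "seg m t i = j" using i near j by (intro seg_eq[OF t]) auto
        moreover have "y i = \<delta> (j - 1) + e i" using i near j by (intro y) auto
        ultimately show "(\<delta> (j - 1) + e i - d j)\<^sup>2 = g i (seg m t i)" by (simp add: g_def)
      qed simp
      also have "\<dots> \<le> (\<Sum>i\<in>?I. g i (seg m t' i))" using 2 s_le by (intro diff) auto
      also have "\<dots> = (\<Sum>i\<in>?I. (\<delta> (j - 1) + e i - d (j - 1))\<^sup>2)"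
      proof (rule sum.cong)
        fix i assume i: "i \<in> ?I"
        have "seg m t' i = j - 1" using mono_t i near j by (intro seg_eq[OF t']) (auto simp: t'_def)
        moreover have "y i = \<delta> (j - 1) + e i" using i near j by (intro y) auto
        ultimately show "g i (seg m t' i) = (\<delta> (j - 1) + e i - d (j - 1))\<^sup>2" by (simp add: g_def)
      qed simp
      finally have "(\<bar>\<delta> (j - 1) - \<delta> j\<bar> - 2 * \<kappa>) * real (card ?I) \<le> 2 * \<bar>\<Sum>i\<in>?I. e i\<bar>"
        using d sep \<eta> by (intro level_comparison) (auto simp: abs_minus_commute[of "\<delta> j"])
      also have "\<bar>\<Sum>i\<in>?I. e i\<bar> \<le> \<eta> * real (card ?I)"
        using left[of "s j - t j"] 2 s_le by simp
      finally have "(\<bar>\<delta> (j - 1) - \<delta> j\<bar> - 2 * \<kappa> - 2 * \<eta>) * real (card ?I) \<le> 0"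
        by (simp add: algebra_simps)
      moreover have "real (card ?I) > 0" using 2 L0 by simp
      ultimately show False using sep by (simp add: mult_le_0_iff abs_minus_commute)
    qed
  qed
qed

text \<open>
  The competitor replaces the level of one segment by the true one. The residuals \<open>y i - \<delta> k\<close> on that segment consist of
  the noise and of jumps at the at most \<open>2 L0\<close> indices that lie outside the true segment.
\<close>
lemma level_rate:
  assumes t: "segmentation m n t" and k: "k \<le> m"
    and opt: "rss m y d t \<le> rss m y (d(k := \<delta> k)) t"
    and near: "\<And>k. k \<le> m + 1 \<Longrightarrow> t k \<le> s k + L0 \<and> s k \<le> t k + L0"
    and gap: "w \<le> t (k + 1) - t k"
    and D: "\<And>k. k \<le> m \<Longrightarrow> \<bar>\<delta> k\<bar> \<le> D"
    and R: "\<And>j. j \<le> n \<Longrightarrow> \<bar>\<Sum>i=1..j. e i\<bar> \<le> R"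
  shows "real w * \<bar>d k - \<delta> k\<bar> \<le> 8 * real L0 * D + 4 * R"
proof -
  let ?I = "{t k + 1..t (k + 1)}"
  have le: "t k \<le> t (k + 1)" "t (k + 1) \<le> n"
    using t k segmentation_le[OF t] by (auto simp: segmentation_def less_imp_le)
  define g where "g d k = (\<Sum>i=t k + 1..t (k + 1). (y i - d k)\<^sup>2)" for d :: "nat \<Rightarrow> real" and k
  have "g d k \<le> g (d(k := \<delta> k)) k"
  proof -
    have "(\<Sum>l\<in>{0..m}. g d l) \<le> (\<Sum>l\<in>{0..m}. g (d(k := \<delta> k)) l)"
      using opt by (simp add: rss_def g_def)
    moreover have "(\<Sum>l\<in>{0..m} - {k}. g d l) = (\<Sum>l\<in>{0..m} - {k}. g (d(k := \<delta> k)) l)"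
      by (intro sum.cong) (auto simp: g_def)
    ultimately show ?thesis
      using sum.remove[of "{0..m}" k "g d"] sum.remove[of "{0..m}" k "g (d(k := \<delta> k))"] k by simp
  qed
  then have "real (card ?I) * \<bar>d k - \<delta> k\<bar> \<le> 2 * \<bar>\<Sum>i\<in>?I. (y i - \<delta> k)\<bar>"
    by (intro level_error) (simp add: g_def)
  moreover have "real w * \<bar>d k - \<delta> k\<bar> \<le> real (card ?I) * \<bar>d k - \<delta> k\<bar>"
    using gap by (intro mult_right_mono) auto
  moreover have "\<bar>\<Sum>i\<in>?I. (y i - \<delta> k)\<bar> \<le> 4 * real L0 * D + 2 * R"
  proof -
    have D0: "0 \<le> D" using D[OF k] by simp
    let ?B = "{t k + 1..s k} \<union> {s (k + 1) + 1..t (k + 1)}"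
    have "(\<Sum>i\<in>?I. (y i - \<delta> k)) = (\<Sum>i\<in>?I. \<delta> (seg m s i) - \<delta> k) + (\<Sum>i\<in>?I. e i)"
      unfolding sum.distrib [symmetric] using y_eq le by (intro sum.cong) auto
    moreover have "\<bar>\<Sum>i\<in>?I. e i\<bar> \<le> 2 * R"
      using sum_interval_diff[OF le(1), of e] R[of "t k"] R[of "t (k + 1)"] le by linarith
    moreover have "\<bar>\<Sum>i\<in>?I. \<delta> (seg m s i) - \<delta> k\<bar> \<le> 4 * real L0 * D"
    proof -
      have "\<bar>\<Sum>i\<in>?I. \<delta> (seg m s i) - \<delta> k\<bar> \<le> (\<Sum>i\<in>?I. \<bar>\<delta> (seg m s i) - \<delta> k\<bar>)"
        by (rule sum_abs)
      also have "\<dots> \<le> (\<Sum>i\<in>?I. 2 * D * indicator ?B i)"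
      proof (rule sum_mono)
        fix i assume i: "i \<in> ?I"
        show "\<bar>\<delta> (seg m s i) - \<delta> k\<bar> \<le> 2 * D * indicator ?B i"
        proof (cases "i \<in> ?B")
          case True
          then show ?thesis using D[OF seg_le[of m s i]] D[OF k] by simp
        next
          case False
          then have "seg m s i = k" using i k by (intro seg_eq[OF s]) auto
          then show ?thesis using D0 by simp
        qed
      qed
      also have "\<dots> = (\<Sum>i\<in>?I \<inter> ?B. 2 * D)" 
        by (subst sum.inter_restrict) (auto intro!: sum.cong simp: indicator_def)
      also have "\<dots> = 2 * D * real (card (?I \<inter> ?B))" by simp
      also have "card (?I \<inter> ?B) \<le> card ?B" by (intro card_mono) auto
      also have "card ?B \<le> card {t k + 1..s k} + card {s (k + 1) + 1..t (k + 1)}"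
        by (rule card_Un_le)
      also have "\<dots> \<le> 2 * L0"
      proof -
        have "s k - t k \<le> L0" "t (k + 1) - s (k + 1) \<le> L0"
          using near[of k] near[of "k + 1"] k by auto
        then show ?thesis by simp
      qed
      finally show ?thesis using D0 by (simp add: mult_left_mono mult_ac)
    qed
    ultimately show ?thesis by linarith
  qed
  ultimately show ?thesis by linarith
qed

text \<open>
  By \<open>risk_bound\<close> and \<open>small\<close> the risk is at most \<open>w (J / 8)\<^sup>2\<close>, which brings the change-points within \<open>w\<close> of
  the true ones and the levels within \<open>J / 8\<close>. With \<open>\<kappa> = \<eta> = J / 8\<close> this is close enough for \<open>change_point_rate\<close>, and
  \<open>\<Delta> \<le> w\<close> makes the competitors used there admissible.
\<close>
theorem estimation_error:
  assumes t: "segmentation m n t"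
    and t_gap: "\<And>k. k \<le> m \<Longrightarrow> \<Delta> \<le> real (t (k + 1)) - real (t k)"
    and opt: "\<And>d' t'. segmentation m n t' \<Longrightarrow> (\<And>k. k \<le> m \<Longrightarrow> \<Delta> \<le> real (t' (k + 1)) - real (t' k)) \<Longrightarrow>
       rss m y d t \<le> rss m y d' t'"
    and \<Delta>: "0 < \<Delta>" "\<Delta> \<le> real w"
    and J: "\<And>k. k \<in> {1..m} \<Longrightarrow> J \<le> \<bar>\<delta> k - \<delta> (k - 1)\<bar>" "J > 0"
    and D: "\<And>k. k \<le> m \<Longrightarrow> \<bar>\<delta> k\<bar> \<le> D"
    and gap: "\<And>k. k \<le> m \<Longrightarrow> s k + 3 * w \<le> s (k + 1)"
    and R: "\<And>j. j \<le> n \<Longrightarrow> \<bar>\<Sum>i=1..j. e i\<bar> \<le> R"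
    and small: "16 * real (m + 1) * R * D + 16 * (real (m + 1) * R)\<^sup>2 / \<Delta> \<le> real w * (J / 8)\<^sup>2"
    and right: "\<And>j L. j \<in> {1..m} \<Longrightarrow> L0 \<le> L \<Longrightarrow> s j + L \<le> n \<Longrightarrow>
       \<bar>\<Sum>i=s j + 1..s j + L. e i\<bar> \<le> J / 8 * real L"
    and left: "\<And>j L. j \<in> {1..m} \<Longrightarrow> L0 \<le> L \<Longrightarrow> L \<le> s j \<Longrightarrow>
       \<bar>\<Sum>i=s j - L + 1..s j. e i\<bar> \<le> J / 8 * real L"
    and L0: "L0 > 0"
  shows "k \<le> m + 1 \<Longrightarrow> t k < s k + L0 \<and> s k < t k + L0"
    and "k \<le> m \<Longrightarrow> real w * \<bar>d k - \<delta> k\<bar> \<le> 8 * real L0 * D + 4 * R"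
proof -
  have w: "w > 0" using \<Delta> by (cases "w = 0") auto
  have s_gap: "\<Delta> \<le> real (s (k + 1)) - real (s k)" if "k \<le> m" for k
  proof -
    have "real (s k + 3 * w) \<le> real (s (k + 1))" using gap[OF that] by (simp only: of_nat_le_iff)
    then show ?thesis using \<Delta> by simp
  qed
  have "risk d t \<le> 16 * real (m + 1) * R * D + 16 * (real (m + 1) * R)\<^sup>2 / \<Delta>"
    by (rule risk_bound[OF t opt[OF s s_gap] t_gap \<Delta>(1) D R])
  then have risk: "risk d t \<le> real w * (J / 8)\<^sup>2" using small by linarith
  have near: "t k < s k + w \<and> s k < t k + w" if "k \<le> m + 1" for k
  proof (rule consistency[OF t J])
    show "s k + 2 * w \<le> s (k + 1)" if "k \<le> m" for k using gap[OF that] by simp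
    have "0 < real w * J\<^sup>2" using w J(2) by simp
    then show "2 * risk d t < real w * J\<^sup>2" using risk by (simp add: power_divide)
  qed (use that in auto)
  have level: "\<bar>d k - \<delta> k\<bar> \<le> J / 8" if "k \<le> m" for k
  proof (rule level_consistency[OF t _ gap risk _ w that])
    show "t k \<le> s k + w \<and> s k \<le> t k + w" if "k \<le> m + 1" for k using near[OF that] by simp
  qed (use J in auto)
  have rate: "t j < s j + L0 \<and> s j < t j + L0" if j: "j \<in> {1..m}" for j
  proof (rule change_point_rate[OF t j])
    have j': "j - 1 \<le> m" "j - 1 + 1 = j" "j \<le> m" using j by auto
    have g: "s (j - 1) + 3 * w \<le> s j" "s j + 3 * w \<le> s (j + 1)"
      using gap[OF j'(1)] gap[OF j'(3)] j'(2) by auto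
    have n: "t (j - 1) < s (j - 1) + w" "t j < s j + w" "s j < t j + w" "s (j + 1) < t (j + 1) + w"
      using near[of "j - 1"] near[of j] near[of "j + 1"] j by auto
    show nr: "s (j - 1) \<le> t j" "t j \<le> s (j + 1)" "t (j - 1) < s j" "s j < t (j + 1)"
      using g n j by auto
    show "rss m y d t \<le> rss m y d (t(j := s j))"
    proof (rule opt)
      show "segmentation m n (t(j := s j))"
        using t nr j unfolding segmentation_def by (auto simp: fun_upd_def)
      have "t (j - 1) + w \<le> s j" "s j + w \<le> t (j + 1)" using g n j by auto
      then have "real (t (j - 1)) + real w \<le> real (s j)" "real (s j) + real w \<le> real (t (j + 1))"
        by linarith+
      then show "\<Delta> \<le> real ((t(j := s j)) (k + 1)) - real ((t(j := s j)) k)" if "k \<le> m" for k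
        using t_gap[OF that] \<Delta>(2) by (auto simp: fun_upd_def)
    qed
    show "\<bar>d (j - 1) - \<delta> (j - 1)\<bar> \<le> J / 8" "\<bar>d j - \<delta> j\<bar> \<le> J / 8"
      using level j by auto
    show "2 * (J / 8) + 2 * (J / 8) < \<bar>\<delta> j - \<delta> (j - 1)\<bar>" using J(1)[OF j] J(2) by simp
    show "0 \<le> J / 8" using J(2) by simp
  qed (use right left j L0 in auto)
  have near': "t k < s k + L0 \<and> s k < t k + L0" if "k \<le> m + 1" for k
  proof (cases "k \<in> {1..m}")
    case False
    then have "k = 0 \<or> k = m + 1" using that by auto
    then show ?thesis using s t L0 by (auto simp: segmentation_def)
  qed (rule rate)
  then show "k \<le> m + 1 \<Longrightarrow> t k < s k + L0 \<and> s k < t k + L0" .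
  show "real w * \<bar>d k - \<delta> k\<bar> \<le> 8 * real L0 * D + 4 * R" if k: "k \<le> m"
  proof (rule level_rate[OF t k opt[OF t t_gap] _ _ D R])
    show "t k \<le> s k + L0 \<and> s k \<le> t k + L0" if "k \<le> m + 1" for k using near'[OF that] by simp
    show "w \<le> t (k + 1) - t k" using gap[OF k] near[of k] near[of "k + 1"] k by auto
  qed
qed

end

section \<open>Noise of an autoregression with perturbed coefficient\<close>

lemma autoregression_bound:
  fixes z u :: "nat \<Rightarrow> real"
  assumes rec: "\<And>i. i \<in> {1..n} \<Longrightarrow> z i = \<rho> * z (i - 1) + u i"
    and \<rho>: "\<bar>\<rho>\<bar> < 1" and u: "\<And>i. i \<in> {1..n} \<Longrightarrow> \<bar>u i\<bar> \<le> U" and U: "0 \<le> U"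
    and i: "i \<le> n"
  shows "\<bar>z i\<bar> \<le> \<bar>z 0\<bar> + U / (1 - \<bar>\<rho>\<bar>)"
  using i
proof (induction i)
  case 0
  then show ?case using \<rho> U by simp
next
  case (Suc i)
  have "\<bar>z (Suc i)\<bar> \<le> \<bar>\<rho>\<bar> * \<bar>z i\<bar> + \<bar>u (Suc i)\<bar>"
    using rec[of "Suc i"] Suc.prems abs_triangle_ineq[of "\<rho> * z i" "u (Suc i)"] by (simp add: abs_mult)
  also have "\<dots> \<le> \<bar>\<rho>\<bar> * (\<bar>z 0\<bar> + U / (1 - \<bar>\<rho>\<bar>)) + U"
    using Suc u[of "Suc i"] by (intro add_mono mult_left_mono) auto
  also have "\<dots> = \<bar>\<rho>\<bar> * \<bar>z 0\<bar> + U / (1 - \<bar>\<rho>\<bar>)"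
    using \<rho> by (simp add: field_simps)
  also have "\<dots> \<le> 1 * \<bar>z 0\<bar> + U / (1 - \<bar>\<rho>\<bar>)"
    using \<rho> by (intro add_mono mult_right_mono) auto
  finally show ?case by simp
qed

lemma autoregression_sum:
  fixes z u :: "nat \<Rightarrow> real"
  assumes rec: "\<And>i. i \<in> {1..n} \<Longrightarrow> z i = \<rho> * z (i - 1) + u i" and "a \<le> b" "b \<le> n"
  shows "(1 - \<rho>) * (\<Sum>i=a + 1..b. z (i - 1)) = (\<Sum>i=a + 1..b. u i) + z a - z b"
  using assms(2,3)
proof (induction b rule: dec_induct)
  case (step b)
  then have "z (Suc b) = \<rho> * z b + u (Suc b)" using rec[of "Suc b"] by simp
  moreover have "(1 - \<rho>) * ((\<Sum>i=a + 1..b. z (i - 1)) + z b)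
      = ((\<Sum>i=a + 1..b. u i) + z a - z b) + (z b - \<rho> * z b)"
    using step by (simp add: distrib_left left_diff_distrib)
  ultimately show ?case using step(1) by simp
qed simp

text \<open>
  Bounding the sum of \<open>z (i - 1)\<close> by that of absolute values would be too crude: by \<open>autoregression_sum\<close> it is, up to
  boundary terms, a multiple of the sum of the innovations \<open>f i + \<epsilon> i\<close>.
\<close>
lemma perturbed_noise_sum:
  fixes z u \<epsilon> e :: "nat \<Rightarrow> real"
  assumes rec: "\<And>i. i \<in> {1..n} \<Longrightarrow> z i = \<rho> * z (i - 1) + (f i + \<epsilon> i)"
    and \<rho>: "\<rho> < 1" and ab: "a \<le> b" "b \<le> n"
    and f: "\<And>i. i \<in> {1..n} \<Longrightarrow> \<bar>f i\<bar> \<le> D" and Z: "\<And>i. i \<le> n \<Longrightarrow> \<bar>z i\<bar> \<le> Z"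
  shows "\<bar>\<Sum>i=a + 1..b. \<epsilon> i + r * z (i - 1)\<bar>
    \<le> (1 + \<bar>r\<bar> / (1 - \<rho>)) * \<bar>\<Sum>i=a + 1..b. \<epsilon> i\<bar> + \<bar>r\<bar> / (1 - \<rho>) * (D * real (b - a) + 2 * Z)"
proof -
  define E F where "E = (\<Sum>i=a + 1..b. \<epsilon> i)" and "F = (\<Sum>i=a + 1..b. f i)"
  have "(1 - \<rho>) * (\<Sum>i=a + 1..b. z (i - 1)) = F + E + z a - z b"
    using autoregression_sum[where u = "\<lambda>i. f i + \<epsilon> i", OF rec ab] by (simp add: E_def F_def sum.distrib)
  then have *: "(\<Sum>i=a + 1..b. z (i - 1)) = (F + E + z a - z b) / (1 - \<rho>)"
    using \<rho> by (simp add: field_simps)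
  have "(\<Sum>i=a + 1..b. \<epsilon> i + r * z (i - 1)) = E + r * (\<Sum>i=a + 1..b. z (i - 1))"
    by (simp add: E_def sum.distrib sum_distrib_left)
  also have "\<dots> = E + r / (1 - \<rho>) * (F + E + z a - z b)" unfolding * by simp
  also have "\<bar>\<dots>\<bar> \<le> \<bar>E\<bar> + \<bar>r\<bar> / (1 - \<rho>) * \<bar>F + E + z a - z b\<bar>"
    using \<rho> abs_triangle_ineq[of E "r / (1 - \<rho>) * (F + E + z a - z b)"] by (simp add: abs_mult)
  also have "\<dots> \<le> \<bar>E\<bar> + \<bar>r\<bar> / (1 - \<rho>) * (D * real (b - a) + \<bar>E\<bar> + 2 * Z)"
  proof -
    have "\<bar>F\<bar> \<le> (\<Sum>i=a + 1..b. \<bar>f i\<bar>)" unfolding F_def by (rule sum_abs)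
    also have "\<dots> \<le> (\<Sum>i=a + 1..b. D)" using f ab by (intro sum_mono) auto
    also have "\<dots> = D * real (b - a)" by simp
    finally have "\<bar>F + E + z a - z b\<bar> \<le> D * real (b - a) + \<bar>E\<bar> + 2 * Z"
      using Z[of a] Z[of b] ab by linarith
    then show ?thesis using \<rho> by (intro add_left_mono mult_left_mono) auto
  qed
  finally show ?thesis by (simp add: E_def algebra_simps)
qed

text \<open>
  The non-random core of the theorem, for a fixed \<open>n\<close> and a fixed outcome. \<open>Z\<close> and \<open>R\<close> are the constants
  for which \<open>\<bar>x i\<bar> \<le> Z sqrt n\<close> and the partial sums of the noise \<open>\<epsilon> i + (\<rho> - \<rho>') x (i - 1)\<close> are at most
  \<open>R sqrt n\<close>. The three conditions with \<open>J / 24\<close> share out the local noise budget \<open>J / 8\<close> of \<open>estimation_error\<close>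
  between the three terms of \<open>perturbed_noise_sum\<close>.
\<close>
lemma estimates_on_good_event:
  fixes x \<epsilon> \<delta> d :: "nat \<Rightarrow> real" and s t :: "nat \<Rightarrow> nat" and m n w L0 :: nat and \<Delta> :: "nat \<Rightarrow> real"
    and \<rho> \<rho>' A A0 C D J \<eta> :: real
  defines "Z \<equiv> A0 + (D + 2 * A) / (1 - \<bar>\<rho>\<bar>)"
  defines "q \<equiv> C / (1 - \<rho>)"
  defines "R \<equiv> (1 + q) * A + q * (D + 2 * Z)"
  assumes s: "segmentation m n s"
    and rec: "\<And>k i. k \<le> m \<Longrightarrow> s k < i \<Longrightarrow> i \<le> s (k + 1) \<Longrightarrow> x i = \<rho> * x (i - 1) + \<delta> k + \<epsilon> i"
    and gap: "\<And>k. k \<le> m \<Longrightarrow> s k + 3 * w \<le> s (k + 1)"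
    and J: "\<And>k. k \<in> {1..m} \<Longrightarrow> J \<le> \<bar>\<delta> k - \<delta> (k - 1)\<bar>" "J > 0"
    and D: "\<And>k. k \<le> m \<Longrightarrow> \<bar>\<delta> k\<bar> \<le> D"
    and \<rho>: "\<bar>\<rho>\<bar> < 1" and n: "n \<ge> 1"
    and \<rho>': "\<bar>\<rho>' - \<rho>\<bar> \<le> C / sqrt (real n)"
    and x0: "\<bar>x 0\<bar> \<le> A0"
    and A: "\<And>k. k \<le> n \<Longrightarrow> \<bar>\<Sum>i=1..k. \<epsilon> i\<bar> \<le> A * sqrt (real n)"
    and right: "\<And>j L. j \<in> {1..m} \<Longrightarrow> L0 \<le> L \<Longrightarrow> s j + L \<le> n \<Longrightarrow>
       \<bar>\<Sum>i=s j + 1..s j + L. \<epsilon> i\<bar> \<le> \<eta> * real L"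
    and left: "\<And>j L. j \<in> {1..m} \<Longrightarrow> L0 \<le> L \<Longrightarrow> L \<le> s j \<Longrightarrow>
       \<bar>\<Sum>i=s j - L + 1..s j. \<epsilon> i\<bar> \<le> \<eta> * real L"
    and L0: "L0 > 0"
    and \<eta>: "(1 + q) * \<eta> \<le> J / 24" and qD: "q * D \<le> J / 24 * sqrt (real n)"
    and qZ: "2 * q * Z \<le> J / 24 * real L0"
    and \<Delta>: "0 < \<Delta> n" "\<Delta> n \<le> real w"
    and small: "16 * real (m + 1) * (R * sqrt (real n)) * D + 16 * (real (m + 1) * (R * sqrt (real n)))\<^sup>2 / \<Delta> n
        \<le> real w * (J / 8)\<^sup>2"
    and opt: "is_arg_min (\<lambda>(d, t). SS m x \<rho>' d t) (\<lambda>(d, t). t \<in> admissible \<Delta> n m) (d, t)"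
  shows "k \<le> m + 1 \<Longrightarrow> t k < s k + L0 \<and> s k < t k + L0"
    and "k \<le> m \<Longrightarrow> real w * \<bar>d k - \<delta> k\<bar> \<le> 8 * real L0 * D + 4 * (R * sqrt (real n))"
proof -
  define N where "N = sqrt (real n)"
  define r where "r = \<rho> - \<rho>'"
  define e where "e i = \<epsilon> i + r * x (i - 1)" for i
  have N: "1 \<le> N" "N * N = real n" using n by (auto simp: N_def)
  have rN: "\<bar>r\<bar> * N \<le> C" using \<rho>' N(1) by (simp add: r_def N_def [symmetric] field_simps abs_minus_commute)
  have \<rho>1: "\<rho> < 1" "0 < 1 - \<rho>" using \<rho> by linarith+
  have C0: "0 \<le> C" using rN N(1) by (smt (verit) mult_nonneg_nonneg abs_ge_zero)
  have q0: "0 \<le> q" using C0 \<rho>1 by (simp add: q_def)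
  have D0: "0 \<le> D" using D[of 0] by simp
  have A0: "0 \<le> A0" using x0 by linarith
  have An: "0 \<le> A" using A[of 0] N(1) by (simp add: N_def zero_le_mult_iff)
  have Z0: "0 \<le> Z" using A0 D0 An \<rho> by (simp add: Z_def)
  have rec': "x i = \<rho> * x (i - 1) + (\<delta> (seg m s i) + \<epsilon> i)" if "i \<in> {1..n}" for i
    using rec[OF seg_le[of m s i], of i] seg_bounds[OF s, of i] that by simp
  have \<epsilon>: "\<bar>\<epsilon> i\<bar> \<le> 2 * A * N" if i: "i \<in> {1..n}" for i
  proof -
    obtain i' where i': "i = Suc i'" using i by (cases i) auto
    have "\<epsilon> i = (\<Sum>i=1..i. \<epsilon> i) - (\<Sum>i=1..i'. \<epsilon> i)" by (simp add: i')
    then show ?thesis using A[of i] A[of i'] i i' unfolding N_def [symmetric] by fastforce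
  qed
  have x: "\<bar>x i\<bar> \<le> Z * N" if "i \<le> n" for i
  proof -
    have "\<bar>x i\<bar> \<le> \<bar>x 0\<bar> + (D + 2 * A * N) / (1 - \<bar>\<rho>\<bar>)"
    proof (rule autoregression_bound[where u = "\<lambda>i. \<delta> (seg m s i) + \<epsilon> i", OF rec' \<rho> _ _ that])
      show "\<bar>\<delta> (seg m s i) + \<epsilon> i\<bar> \<le> D + 2 * A * N" if "i \<in> {1..n}" for i
        using D[OF seg_le[of m s i]] \<epsilon>[OF that] by linarith
      show "0 \<le> D + 2 * A * N" using D0 An N by simp
    qed
    also have "\<dots> \<le> A0 * N + (D * N + 2 * A * N) / (1 - \<bar>\<rho>\<bar>)"
    proof (intro add_mono divide_right_mono order_refl)
      show "\<bar>x 0\<bar> \<le> A0 * N" using mult_left_mono[OF N(1) A0] x0 by linarith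
      show "D \<le> D * N" using mult_left_mono[OF N(1) D0] by simp
    qed (use \<rho> in auto)
    also have "\<dots> = Z * N" by (simp add: Z_def algebra_simps add_divide_distrib)
    finally show ?thesis .
  qed
  have r_q: "\<bar>r\<bar> / (1 - \<rho>) * N \<le> q" "\<bar>r\<bar> / (1 - \<rho>) \<le> q"
  proof -
    show 1: "\<bar>r\<bar> / (1 - \<rho>) * N \<le> q" 
      using divide_right_mono[OF rN, of "1 - \<rho>"] \<rho>1 by (simp add: q_def)
    have "\<bar>r\<bar> / (1 - \<rho>) * 1 \<le> \<bar>r\<bar> / (1 - \<rho>) * N" using N \<rho>1 by (intro mult_left_mono) auto
    with 1 show "\<bar>r\<bar> / (1 - \<rho>) \<le> q" by simp
  qed
  have e_sum: "\<bar>\<Sum>i=a + 1..b. e i\<bar> \<le> (1 + q) * \<bar>\<Sum>i=a + 1..b. \<epsilon> i\<bar> + (q * D * real (b - a) / N + 2 * q * Z)"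
    if ab: "a \<le> b" "b \<le> n" for a b
  proof -
    have "\<bar>\<Sum>i=a + 1..b. e i\<bar> \<le> (1 + \<bar>r\<bar> / (1 - \<rho>)) * \<bar>\<Sum>i=a + 1..b. \<epsilon> i\<bar>
        + \<bar>r\<bar> / (1 - \<rho>) * (D * real (b - a) + 2 * (Z * N))"
      unfolding e_def
      by (rule perturbed_noise_sum[where f = "\<lambda>i. \<delta> (seg m s i)" and z = x and \<epsilon> = \<epsilon>, OF rec' \<rho>1(1) ab D[OF seg_le] x])
    also have "\<dots> = (1 + \<bar>r\<bar> / (1 - \<rho>)) * \<bar>\<Sum>i=a + 1..b. \<epsilon> i\<bar>
        + (\<bar>r\<bar> / (1 - \<rho>) * N) * (D * real (b - a) / N + 2 * Z)"
    proof -
      have "g * (D * l + 2 * (Z * N)) = (g * N) * (D * l / N + 2 * Z)" for g l :: real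
        using N(1) by (simp add: field_simps)
      then show ?thesis by (simp only:)
    qed
    also have "\<dots> \<le> (1 + q) * \<bar>\<Sum>i=a + 1..b. \<epsilon> i\<bar> + q * (D * real (b - a) / N + 2 * Z)"
      using r_q D0 Z0 N by (intro add_mono mult_right_mono) auto
    finally show ?thesis by (simp add: algebra_simps)
  qed
  have e_total: "\<bar>\<Sum>i=1..j. e i\<bar> \<le> R * N" if j: "j \<le> n" for j
  proof -
    have "\<bar>\<Sum>i=1..j. e i\<bar> \<le> (1 + q) * \<bar>\<Sum>i=1..j. \<epsilon> i\<bar> + (q * D * real j / N + 2 * q * Z)"
      using e_sum[of 0 j] j by simp
    also have "\<dots> \<le> (1 + q) * (A * N) + (q * D * N + 2 * q * Z * N)"
    proof (intro add_mono mult_left_mono)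
      show "\<bar>\<Sum>i=1..j. \<epsilon> i\<bar> \<le> A * N" using A[OF j] by (simp add: N_def)
      have "q * D * real j \<le> q * D * (N * N)" unfolding N(2) using j q0 D0 by (intro mult_left_mono) auto
      then have "q * D * real j \<le> (q * D * N) * N" by (simp only: mult.assoc)
      then show "q * D * real j / N \<le> q * D * N" using N(1) by (subst pos_divide_le_eq) auto
      show "2 * q * Z \<le> 2 * q * Z * N" using mult_left_mono[OF N(1), of "2 * q * Z"] q0 Z0 by simp
    qed (use q0 in auto)
    also have "\<dots> = R * N" by (simp add: R_def algebra_simps)
    finally show ?thesis .
  qed
  have e_local: "\<bar>\<Sum>i=a + 1..b. e i\<bar> \<le> J / 8 * real L"
    if ab: "a \<le> b" "b \<le> n" and L: "b - a = L" "L0 \<le> L" and \<epsilon>L: "\<bar>\<Sum>i=a + 1..b. \<epsilon> i\<bar> \<le> \<eta> * real L" for a b L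
  proof -
    have "\<bar>\<Sum>i=a + 1..b. e i\<bar> \<le> (1 + q) * \<bar>\<Sum>i=a + 1..b. \<epsilon> i\<bar> + (q * D * real L / N + 2 * q * Z)"
      using e_sum[OF ab] L by simp
    also have "\<dots> \<le> J / 24 * real L + (J / 24 * real L + J / 24 * real L)"
    proof (intro add_mono)
      have "(1 + q) * \<bar>\<Sum>i=a + 1..b. \<epsilon> i\<bar> \<le> (1 + q) * (\<eta> * real L)"
        using \<epsilon>L q0 by (intro mult_left_mono) auto
      also have "\<dots> \<le> J / 24 * real L"
        using mult_right_mono[OF \<eta>, of "real L"] by (simp add: mult.assoc)
      finally show "(1 + q) * \<bar>\<Sum>i=a + 1..b. \<epsilon> i\<bar> \<le> J / 24 * real L" .
      show "q * D * real L / N \<le> J / 24 * real L"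
        using mult_right_mono[OF qD, of "real L"] N unfolding N_def [symmetric] by (simp add: field_simps)
      have "J / 24 * real L0 \<le> J / 24 * real L" using L J(2) by (intro mult_left_mono) auto
      then show "2 * q * Z \<le> J / 24 * real L" using qZ by linarith
    qed
    finally show ?thesis by simp
  qed
  interpret noisy_steps m n s \<delta> "\<lambda>i. x i - \<rho>' * x (i - 1)" e
    by unfold_locales (use s rec in \<open>auto simp: e_def r_def algebra_simps\<close>)
  have adm: "segmentation m n t" "\<And>k. k \<le> m \<Longrightarrow> \<Delta> n \<le> real (t (k + 1)) - real (t k)"
    using opt unfolding is_arg_min_def by (auto simp: admissible_iff)
  have min: "rss m (\<lambda>i. x i - \<rho>' * x (i - 1)) d t \<le> rss m (\<lambda>i. x i - \<rho>' * x (i - 1)) d' t'"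
    if "segmentation m n t'" "\<And>k. k \<le> m \<Longrightarrow> \<Delta> n \<le> real (t' (k + 1)) - real (t' k)" for d' t'
  proof -
    have "t' \<in> admissible \<Delta> n m" using that by (auto simp: admissible_iff)
    then have "\<not> SS m x \<rho>' d' t' < SS m x \<rho>' d t" using opt unfolding is_arg_min_def by auto
    then show ?thesis by (simp add: SS_eq_rss)
  qed
  have right': "\<bar>\<Sum>i=s j + 1..s j + L. e i\<bar> \<le> J / 8 * real L"
    if "j \<in> {1..m}" "L0 \<le> L" "s j + L \<le> n" for j L
    using that right[OF that] by (intro e_local) auto
  have left': "\<bar>\<Sum>i=s j - L + 1..s j. e i\<bar> \<le> J / 8 * real L"
    if "j \<in> {1..m}" "L0 \<le> L" "L \<le> s j" for j L
    using that left[OF that] segmentation_le[OF s, of j] by (intro e_local) auto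
  note est = estimation_error[OF adm min \<Delta> J D gap e_total small[unfolded N_def [symmetric]] right' left' L0]
  show "k \<le> m + 1 \<Longrightarrow> t k < s k + L0 \<and> s k < t k + L0" by (rule est(1))
  show "k \<le> m \<Longrightarrow> real w * \<bar>d k - \<delta> k\<bar> \<le> 8 * real L0 * D + 4 * (R * sqrt (real n))"
    unfolding N_def [symmetric] by (rule est(2))
qed

section \<open>Maximal inequalities for independent noise\<close>

context prob_space begin

text \<open>
  Decompose the event according to the first time \<open>k\<close> at which the partial sum reaches \<open>c\<close>. On that part,
  \<open>S\<^sub>N\<^sup>2 \<ge> S\<^sub>k\<^sup>2 + 2 S\<^sub>k (S\<^sub>N - S\<^sub>k)\<close>, and the last product has mean zero because its first
  factor, restricted to the event, depends only on the first \<open>k\<close> variables. The enumeration \<open>\<pi>\<close> allows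
  partial sums that run forwards or backwards from an arbitrary index of the family.
\<close>
lemma kolmogorov_maximal_inequality:
  fixes X :: "'i \<Rightarrow> 'a \<Rightarrow> real" and \<pi> :: "nat \<Rightarrow> 'i"
  assumes indep: "indep_vars (\<lambda>_. borel) X I"
    and mv: "\<And>i. i \<in> I \<Longrightarrow> has_mean_variance (X i) 0 v"
    and inj: "inj_on \<pi> {..<N}" and sub: "\<pi> ` {..<N} \<subseteq> I"
    and l: "c > 0"
  shows "{\<omega> \<in> space M. \<exists>k\<le>N. \<bar>\<Sum>i<k. X (\<pi> i) \<omega>\<bar> \<ge> c} \<in> events"
    and "prob {\<omega> \<in> space M. \<exists>k\<le>N. \<bar>\<Sum>i<k. X (\<pi> i) \<omega>\<bar> \<ge> c} \<le> real N * v / c\<^sup>2"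
proof -
  define S where "S k \<omega> = (\<Sum>i<k. X (\<pi> i) \<omega>)" for k \<omega>
  \<comment> \<open>\<open>T k\<close> and, below, \<open>Q k\<close> are \<open>S k\<close> and \<open>A k\<close> as functions on the product space of the values, where
      independence of the past from the future is formulated.\<close>
  define T where "T k x = (\<Sum>i<k. x (\<pi> i))" for k and x :: "'i \<Rightarrow> real"
  have X: "random_variable borel (X (\<pi> i))" "integrable M (X (\<pi> i))"
    "integrable M (\<lambda>\<omega>. (X (\<pi> i) \<omega>)\<^sup>2)" "expectation (X (\<pi> i)) = 0"
    "expectation (\<lambda>\<omega>. (X (\<pi> i) \<omega>)\<^sup>2) = v" if "i < N" for i
  proof -
    have "\<pi> i \<in> I" using sub that by auto
    from mv[OF this] show "random_variable borel (X (\<pi> i))" "integrable M (X (\<pi> i))"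
      "integrable M (\<lambda>\<omega>. (X (\<pi> i) \<omega>)\<^sup>2)" "expectation (X (\<pi> i)) = 0"
      "expectation (\<lambda>\<omega>. (X (\<pi> i) \<omega>)\<^sup>2) = v"
      unfolding has_mean_variance_def by (elim conjE; simp)+
  qed
  have S_meas [measurable]: "S k \<in> borel_measurable M" if "k \<le> N" for k
    unfolding S_def[abs_def] using X(1) that by (intro borel_measurable_sum) auto
  have prod_int: "integrable M (\<lambda>\<omega>. X (\<pi> i) \<omega> * X (\<pi> j) \<omega>)" if "i < N" "j < N" for i j
  proof (rule Bochner_Integration.integrable_bound)
    show "integrable M (\<lambda>\<omega>. (X (\<pi> i) \<omega>)\<^sup>2 + (X (\<pi> j) \<omega>)\<^sup>2)" using X that by auto
    show "(\<lambda>\<omega>. X (\<pi> i) \<omega> * X (\<pi> j) \<omega>) \<in> borel_measurable M" using X that by auto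
    have "\<bar>a * b\<bar> \<le> a\<^sup>2 + b\<^sup>2" for a b :: real
    proof -
      have "2 * (\<bar>a\<bar> * \<bar>b\<bar>) \<le> a\<^sup>2 + b\<^sup>2"
        using sum_squares_bound[of "\<bar>a\<bar>" "\<bar>b\<bar>"] by (simp add: mult.assoc)
      moreover have "0 \<le> \<bar>a\<bar> * \<bar>b\<bar>" by simp
      ultimately show ?thesis unfolding abs_mult by linarith
    qed
    then show "AE \<omega> in M. norm (X (\<pi> i) \<omega> * X (\<pi> j) \<omega>) \<le> norm ((X (\<pi> i) \<omega>)\<^sup>2 + (X (\<pi> j) \<omega>)\<^sup>2)"
      by (auto intro!: AE_I2)
  qed
  have SS_int: "integrable M (\<lambda>\<omega>. S j \<omega> * S k \<omega>)" if "j \<le> N" "k \<le> N" for j k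
    unfolding S_def sum_product using that by (intro Bochner_Integration.integrable_sum prod_int) auto
  have orth: "integrable M (\<lambda>\<omega>. S k \<omega> * h (\<lambda>i\<in>\<pi> ` {..<k}. X i \<omega>) * (S l \<omega> - S k \<omega>))
     \<and> expectation (\<lambda>\<omega>. S k \<omega> * h (\<lambda>i\<in>\<pi> ` {..<k}. X i \<omega>) * (S l \<omega> - S k \<omega>)) = 0"
    if h: "h \<in> borel_measurable (PiM (\<pi> ` {..<k}) (\<lambda>_. borel))" and hb: "\<And>x. \<bar>h x\<bar> \<le> 1"
      and kl: "k \<le> l" "l \<le> N" for h :: "('i \<Rightarrow> real) \<Rightarrow> real" and k l
  proof -
    let ?A = "\<pi> ` {..<k}" and ?B = "\<pi> ` {k..<l}"
    have disj: "?A \<inter> ?B = {}" using inj kl by (force simp: inj_on_def)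
    have AB: "?A \<subseteq> I" "?B \<subseteq> I" using sub kl by (auto simp: image_subset_iff)
    note ir = indep_var_restrict[OF indep disj AB]
    have 1: "(\<lambda>x. T k x * h x) \<in> borel_measurable (PiM ?A (\<lambda>_. borel))"
      unfolding T_def[abs_def] using h
      by (intro borel_measurable_times borel_measurable_sum measurable_component_singleton) auto
    have 2: "(\<lambda>x. \<Sum>i=k..<l. x (\<pi> i)) \<in> borel_measurable (PiM ?B (\<lambda>_. borel :: real measure))"
      by (intro borel_measurable_sum measurable_component_singleton) auto
    have TS: "T k (\<lambda>i\<in>?A. X i \<omega>) = S k \<omega>" for \<omega> by (simp add: T_def S_def)
    have DS: "(\<Sum>i=k..<l. (\<lambda>i\<in>?B. X i \<omega>) (\<pi> i)) = S l \<omega> - S k \<omega>" for \<omega>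
      using kl by (simp add: S_def sum_diff_nat_ivl lessThan_atLeast0 sum_diff_nat_ivl[of 0 k l])
    note iv = indep_var_compose[OF ir 1 2, unfolded comp_def TS DS]
    have iS: "integrable M (S j)" if "j \<le> N" for j
      unfolding S_def[abs_def] using X that by (intro Bochner_Integration.integrable_sum) auto
    have eS: "expectation (S j) = 0" if "j \<le> N" for j
      unfolding S_def[abs_def] using X that by (subst Bochner_Integration.integral_sum) auto
    have i1: "integrable M (\<lambda>\<omega>. S k \<omega> * h (\<lambda>i\<in>?A. X i \<omega>))"
    proof (rule Bochner_Integration.integrable_bound[OF iS[of k]])
      show "k \<le> N" using kl by simp
      show "(\<lambda>\<omega>. S k \<omega> * h (\<lambda>i\<in>?A. X i \<omega>)) \<in> borel_measurable M"
        using iv by (auto simp: indep_var_def indep_vars_def2 split: bool.splits)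
      show "AE \<omega> in M. norm (S k \<omega> * h (\<lambda>i\<in>?A. X i \<omega>)) \<le> norm (S k \<omega>)"
        using hb by (auto intro!: AE_I2 simp: abs_mult mult_left_le)
    qed
    have i2: "integrable M (\<lambda>\<omega>. S l \<omega> - S k \<omega>)" using iS kl by auto
    have "expectation (\<lambda>\<omega>. S l \<omega> - S k \<omega>) = 0"
      using iS kl eS by (subst Bochner_Integration.integral_diff) auto
    then show ?thesis
      using indep_var_integrable[OF iv i1 i2] indep_var_lebesgue_integral[OF iv i1 i2] by auto
  qed
  have ES: "expectation (\<lambda>\<omega>. (S k \<omega>)\<^sup>2) = real k * v" if "k \<le> N" for k
    using that
  proof (induction k)
    case 0 then show ?case by (simp add: S_def)
  next
    case (Suc k)
    have o: "integrable M (\<lambda>\<omega>. S k \<omega> * X (\<pi> k) \<omega>)" "expectation (\<lambda>\<omega>. S k \<omega> * X (\<pi> k) \<omega>) = 0"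
      using orth[of "\<lambda>_. 1" k "Suc k"] Suc.prems by (auto simp: S_def)
    have "expectation (\<lambda>\<omega>. (S (Suc k) \<omega>)\<^sup>2)
        = expectation (\<lambda>\<omega>. (S k \<omega>)\<^sup>2 + (2 * (S k \<omega> * X (\<pi> k) \<omega>) + (X (\<pi> k) \<omega>)\<^sup>2))"
      by (intro Bochner_Integration.integral_cong) (auto simp: S_def power2_eq_square algebra_simps)
    also have "\<dots> = expectation (\<lambda>\<omega>. (S k \<omega>)\<^sup>2) + (2 * 0 + v)"
      using o X[of k] Suc.prems SS_int[of k k]
      by (simp add: power2_eq_square)
    finally show ?case using Suc by (simp add: algebra_simps)
  qed
  define Q where "Q k = {x. c \<le> \<bar>T k x\<bar> \<and> (\<forall>j<k. \<bar>T j x\<bar> < c)}" for k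
  define A where "A k = {\<omega> \<in> space M. c \<le> \<bar>S k \<omega>\<bar> \<and> (\<forall>j<k. \<bar>S j \<omega>\<bar> < c)}" for k
  have A_ev: "A k \<in> events" if "k \<le> N" for k
    using that unfolding A_def
    by (intro sets.sets_Collect_conj sets.sets_Collect_finite_All'
        borel_measurable_le borel_measurable_less borel_measurable_abs S_meas) auto
  have A_disj: "disjoint_family_on A {..N}"
  proof -
    have "A j \<inter> A k = {}" if "j < k" for j k
      using that by (force simp: A_def)
    then show ?thesis
      unfolding disjoint_family_on_def by (metis inf_commute linorder_neqE_nat)
  qed
  have A_Un: "{\<omega> \<in> space M. \<exists>k\<le>N. \<bar>S k \<omega>\<bar> \<ge> c} = (\<Union>k\<le>N. A k)"
  proof (intro equalityI subsetI)
    fix \<omega> assume "\<omega> \<in> {\<omega> \<in> space M. \<exists>k\<le>N. \<bar>S k \<omega>\<bar> \<ge> c}"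
    then obtain k where k: "\<omega> \<in> space M" "k \<le> N" "\<bar>S k \<omega>\<bar> \<ge> c" by auto
    define j where "j = (LEAST j. \<bar>S j \<omega>\<bar> \<ge> c)"
    have "\<bar>S j \<omega>\<bar> \<ge> c" unfolding j_def using k(3) by (rule LeastI)
    moreover have "j \<le> k" unfolding j_def using k(3) by (rule Least_le)
    moreover have "\<bar>S i \<omega>\<bar> < c" if "i < j" for i
      using not_less_Least[of i] that unfolding j_def by force
    ultimately show "\<omega> \<in> (\<Union>k\<le>N. A k)" using k by (auto simp: A_def)
  qed (auto simp: A_def)
  show ev: "{\<omega> \<in> space M. \<exists>k\<le>N. \<bar>\<Sum>i<k. X (\<pi> i) \<omega>\<bar> \<ge> c} \<in> events"
    using A_Un A_ev by (simp add: S_def)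
  have step: "c\<^sup>2 * prob (A k) \<le> expectation (\<lambda>\<omega>. indicator (A k) \<omega> * (S N \<omega>)\<^sup>2)" if k: "k \<le> N" for k
  proof -
    let ?h = "indicator (Q k) :: ('i \<Rightarrow> real) \<Rightarrow> real"
    have hm: "?h \<in> borel_measurable (PiM (\<pi> ` {..<k}) (\<lambda>_. borel))"
    proof -
      have T [measurable]: "T j \<in> borel_measurable (PiM (\<pi> ` {..<k}) (\<lambda>_. borel))" if "j \<le> k" for j
        unfolding T_def[abs_def] using that
        by (intro borel_measurable_sum measurable_component_singleton) auto
      have "Measurable.pred (PiM (\<pi> ` {..<k}) (\<lambda>_. borel)) (\<lambda>x. x \<in> Q k)"
        unfolding Q_def mem_Collect_eq by measurable
      then show ?thesis by (intro borel_measurable_indicator') (simp add: pred_def)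
    qed
    have hA: "?h (\<lambda>i\<in>\<pi> ` {..<k}. X i \<omega>) = indicator (A k) \<omega>" if "\<omega> \<in> space M" for \<omega>
      using that by (auto simp: indicator_def Q_def A_def T_def S_def)
    have o: "integrable M (\<lambda>\<omega>. S k \<omega> * indicator (A k) \<omega> * (S N \<omega> - S k \<omega>))"
        "expectation (\<lambda>\<omega>. S k \<omega> * indicator (A k) \<omega> * (S N \<omega> - S k \<omega>)) = 0"
    proof -
      have bound: "\<bar>?h x\<bar> \<le> 1" for x by (simp add: indicator_def)
      note o' = orth[OF hm bound k order_refl]
      show "integrable M (\<lambda>\<omega>. S k \<omega> * indicator (A k) \<omega> * (S N \<omega> - S k \<omega>))"
        using conjunct1[OF o']
        by (rule iffD1[OF Bochner_Integration.integrable_cong[OF refl], rotated]) (simp only: hA)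
      show "expectation (\<lambda>\<omega>. S k \<omega> * indicator (A k) \<omega> * (S N \<omega> - S k \<omega>)) = 0"
        using conjunct2[OF o']
        by (rule trans[OF Bochner_Integration.integral_cong[OF refl], rotated]) (simp only: hA)
    qed
    have iA: "integrable M (\<lambda>\<omega>. indicator (A k) \<omega> * (S l \<omega>)\<^sup>2)" if "l \<le> N" for l
      using integrable_real_mult_indicator[OF A_ev[OF k] SS_int[OF that that]]
      by (simp add: power2_eq_square mult.commute)
    have "c\<^sup>2 * prob (A k) = expectation (\<lambda>\<omega>. c\<^sup>2 * indicator (A k) \<omega>)"
      using A_ev[OF k] by simp
    also have "\<dots> \<le> expectation (\<lambda>\<omega>. indicator (A k) \<omega> * (S k \<omega>)\<^sup>2)"
    proof (rule integral_mono)
      show "integrable M (\<lambda>\<omega>. c\<^sup>2 * indicator (A k) \<omega>)"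
        using A_ev[OF k] by (intro integrable_mult_right integrable_real_indicator) (auto simp: emeasure_eq_measure)
      show "integrable M (\<lambda>\<omega>. indicator (A k) \<omega> * (S k \<omega>)\<^sup>2)" using iA k by simp
      show "c\<^sup>2 * indicator (A k) \<omega> \<le> indicator (A k) \<omega> * (S k \<omega>)\<^sup>2" for \<omega>
        using l power_mono[of c "\<bar>S k \<omega>\<bar>" 2] by (auto simp: indicator_def A_def)
    qed
    also have "\<dots> = expectation (\<lambda>\<omega>. indicator (A k) \<omega> * (S k \<omega>)\<^sup>2
        + 2 * (S k \<omega> * indicator (A k) \<omega> * (S N \<omega> - S k \<omega>)))"
      using iA[OF k] o by simp
    also have "\<dots> \<le> expectation (\<lambda>\<omega>. indicator (A k) \<omega> * (S N \<omega>)\<^sup>2)"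
    proof (rule integral_mono)
      fix \<omega>
      have "a\<^sup>2 + 2 * (a * (b - a)) \<le> b\<^sup>2" for a b :: real
        using zero_le_power2[of "b - a"] by (simp add: power2_eq_square algebra_simps)
      then show "indicator (A k) \<omega> * (S k \<omega>)\<^sup>2
        + 2 * (S k \<omega> * indicator (A k) \<omega> * (S N \<omega> - S k \<omega>)) \<le> indicator (A k) \<omega> * (S N \<omega>)\<^sup>2"
        by (auto simp: indicator_def)
    qed (use iA k o in auto)
    finally show ?thesis .
  qed
  have iA: "integrable M (\<lambda>\<omega>. indicator (A k) \<omega> * (S N \<omega>)\<^sup>2)" if "k \<le> N" for k
    using integrable_real_mult_indicator[OF A_ev[OF that] SS_int[of N N]]
    by (simp add: power2_eq_square mult.commute)
  have "c\<^sup>2 * prob (\<Union>k\<le>N. A k) = (\<Sum>k\<le>N. c\<^sup>2 * prob (A k))"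
    using A_ev A_disj by (subst finite_measure_finite_Union) (auto simp: sum_distrib_left)
  also have "\<dots> \<le> (\<Sum>k\<le>N. expectation (\<lambda>\<omega>. indicator (A k) \<omega> * (S N \<omega>)\<^sup>2))"
    using step by (intro sum_mono) auto
  also have "\<dots> = expectation (\<lambda>\<omega>. \<Sum>k\<le>N. indicator (A k) \<omega> * (S N \<omega>)\<^sup>2)"
    using iA by (subst Bochner_Integration.integral_sum) auto
  also have "\<dots> \<le> expectation (\<lambda>\<omega>. (S N \<omega>)\<^sup>2)"
  proof (rule integral_mono)
    show "integrable M (\<lambda>\<omega>. \<Sum>k\<le>N. indicator (A k) \<omega> * (S N \<omega>)\<^sup>2)"
      by (intro Bochner_Integration.integrable_sum iA) auto
    show "integrable M (\<lambda>\<omega>. (S N \<omega>)\<^sup>2)"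
      using SS_int[of N N] by (simp add: power2_eq_square)
    fix \<omega>
    have "(\<Sum>k\<le>N. indicator (A k) \<omega> * (S N \<omega>)\<^sup>2) = indicator (\<Union>k\<le>N. A k) \<omega> * (S N \<omega>)\<^sup>2"
      using A_disj by (simp add: sum_distrib_right [symmetric] indicator_UN_disjoint)
    also have "\<dots> \<le> (S N \<omega>)\<^sup>2" by (simp add: indicator_def)
    finally show "(\<Sum>k\<le>N. indicator (A k) \<omega> * (S N \<omega>)\<^sup>2) \<le> (S N \<omega>)\<^sup>2" .
  qed
  also have "\<dots> = real N * v" using ES[of N] by simp
  finally have "prob (\<Union>k\<le>N. A k) \<le> real N * v / c\<^sup>2"
    using l by (simp add: field_simps)
  then show "prob {\<omega> \<in> space M. \<exists>k\<le>N. \<bar>\<Sum>i<k. X (\<pi> i) \<omega>\<bar> \<ge> c} \<le> real N * v / c\<^sup>2"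
    using A_Un by (simp add: S_def)
qed

text \<open>
  For \<open>L\<close> in \<open>[2 ^ p, 2 ^ (p + 1))\<close> it suffices that the maximum of the first \<open>2 ^ (p + 1)\<close> partial sums stays below \<open>\<eta> 2 ^ p\<close>.
  Kolmogorov's inequality bounds the probability of the contrary by \<open>2 v / (\<eta>\<^sup>2 2 ^ p)\<close>, which is summable in
  \<open>p\<close>, so that the total probability is small for large \<open>p0\<close>, uniformly in \<open>N\<close>.
\<close>
lemma dyadic_deviation_bound:
  fixes X :: "'i \<Rightarrow> 'a \<Rightarrow> real" and \<pi> :: "nat \<Rightarrow> 'i"
  assumes indep: "indep_vars (\<lambda>_. borel) X I"
    and mv: "\<And>i. i \<in> I \<Longrightarrow> has_mean_variance (X i) 0 v"
    and inj: "inj_on \<pi> {..<N}" and sub: "\<pi> ` {..<N} \<subseteq> I"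
    and \<eta>: "\<eta> > 0" and v: "0 \<le> v"
  shows "\<exists>B\<in>events. prob B \<le> 4 * v / (\<eta>\<^sup>2 * 2 ^ p0) \<and>
    (\<forall>\<omega>\<in>space M - B. \<forall>L. 2 ^ p0 \<le> L \<longrightarrow> L \<le> N \<longrightarrow> \<bar>\<Sum>i<L. X (\<pi> i) \<omega>\<bar> \<le> \<eta> * real L)"
proof -
  \<comment> \<open>The minimum with \<open>N\<close> keeps the last block inside the range on which \<open>\<pi>\<close> is injective.\<close>
  define K where "K p = min N (2 ^ (p + 1))" for p :: nat
  define B where "B p = {\<omega> \<in> space M. \<exists>k\<le>K p. \<bar>\<Sum>i<k. X (\<pi> i) \<omega>\<bar> \<ge> \<eta> * 2 ^ p}" for p
  have B: "B p \<in> events" "prob (B p) \<le> 2 * v / \<eta>\<^sup>2 * (1 / 2) ^ p" for p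
  proof -
    have K: "inj_on \<pi> {..<K p}" "\<pi> ` {..<K p} \<subseteq> I" "0 < \<eta> * 2 ^ p"
      using inj sub \<eta> by (auto simp: K_def intro: inj_on_subset)
    note kol = kolmogorov_maximal_inequality[OF indep mv K]
    show "B p \<in> events" unfolding B_def by (rule kol(1))
    have "prob (B p) \<le> real (K p) * v / (\<eta> * 2 ^ p)\<^sup>2" unfolding B_def by (rule kol(2))
    also have "\<dots> \<le> 2 ^ (p + 1) * v / (\<eta> * 2 ^ p)\<^sup>2"
    proof -
      have "real (K p) \<le> real (2 ^ (p + 1))" unfolding of_nat_le_iff by (simp add: K_def)
      then show ?thesis using v by (intro divide_right_mono mult_right_mono) auto
    qed
    also have "\<dots> = 2 * v / \<eta>\<^sup>2 * (1 / 2) ^ p"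
      using \<eta> by (simp add: power_mult_distrib power_divide power2_eq_square)
    finally show "prob (B p) \<le> 2 * v / \<eta>\<^sup>2 * (1 / 2) ^ p" .
  qed
  have geom: "(\<Sum>p=p0..<p0 + q. (1 / 2) ^ p) = 2 * (1 / 2) ^ p0 - 2 * (1 / 2 :: real) ^ (p0 + q)" for q
    by (induction q) auto
  define U where "U = (\<Union>p\<in>{p0..<p0 + N}. B p)"
  have "prob U \<le> (\<Sum>p=p0..<p0 + N. prob (B p))"
    unfolding U_def using B(1) by (intro finite_measure_subadditive_finite) auto
  also have "\<dots> \<le> (\<Sum>p=p0..<p0 + N. 2 * v / \<eta>\<^sup>2 * (1 / 2) ^ p)"
    using B(2) by (intro sum_mono) auto
  also have "\<dots> = 2 * v / \<eta>\<^sup>2 * (2 * (1 / 2) ^ p0 - 2 * (1 / 2) ^ (p0 + N))"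
    unfolding sum_distrib_left [symmetric] geom ..
  also have "\<dots> \<le> 2 * v / \<eta>\<^sup>2 * (2 * (1 / 2) ^ p0)"
    using v by (intro mult_left_mono) auto
  also have "\<dots> = 4 * v / (\<eta>\<^sup>2 * 2 ^ p0)" by (simp add: power_divide)
  finally have "prob U \<le> 4 * v / (\<eta>\<^sup>2 * 2 ^ p0)" .
  moreover have "U \<in> events" unfolding U_def using B(1) by auto
  moreover have "\<bar>\<Sum>i<L. X (\<pi> i) \<omega>\<bar> \<le> \<eta> * real L"
    if \<omega>: "\<omega> \<in> space M - U" and L: "2 ^ p0 \<le> L" "L \<le> N" for \<omega> L
  proof -
    have "1 \<le> L" using L(1) by (meson le_trans one_le_numeral one_le_power)
    then obtain p where p: "2 ^ p \<le> L" "L < 2 ^ (p + 1)"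
      using ex_power_ivl1[of 2 L] by auto
    have "(2::nat) ^ p0 < 2 ^ (p + 1)" using L p by linarith
    then have "p0 \<le> p" using power_less_imp_less_exp[of "2::nat" p0 "p + 1"] by simp
    moreover have "p < N" using p L less_exp[of p] by linarith
    ultimately have "\<omega> \<notin> B p" using \<omega> by (auto simp: U_def)
    moreover have "L \<le> K p" using p L by (simp add: K_def)
    ultimately have "\<bar>\<Sum>i<L. X (\<pi> i) \<omega>\<bar> < \<eta> * 2 ^ p" using \<omega> by (force simp: B_def)
    also have "\<dots> \<le> \<eta> * real L"
    proof -
      have "real (2 ^ p) \<le> real L" using p(1) by (simp only: of_nat_le_iff)
      then show ?thesis using \<eta> by (intro mult_left_mono) auto
    qed
    finally show ?thesis by simp
  qed
  ultimately show ?thesis by blast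
qed

text \<open>
  Tightness is expressed here and below through exceptional events: this form combines by unions.
\<close>
lemma partial_sums_tight:
  assumes iid: "iid_mean_variance \<epsilon> {1..} 0 v" and v: "0 \<le> v" and p: "0 < p"
  shows "\<exists>A>0. \<forall>n\<ge>1. \<exists>B\<in>events. prob B < p \<and>
    (\<forall>\<omega>\<in>space M - B. \<forall>k\<le>n. \<bar>\<Sum>i=1..k. \<epsilon> i \<omega>\<bar> \<le> A * sqrt (real n))"
proof -
  define A where "A = sqrt (v / p + 1)"
  have A2: "A\<^sup>2 = v / p + 1" using v p by (simp add: A_def add_nonneg_nonneg)
  have "0 < v / p + 1" using v p by (simp add: add_nonneg_pos)
  then have A: "A > 0" by (simp add: A_def)
  have "\<exists>B\<in>events. prob B < p \<and>
    (\<forall>\<omega>\<in>space M - B. \<forall>k\<le>n. \<bar>\<Sum>i=1..k. \<epsilon> i \<omega>\<bar> \<le> A * sqrt (real n))" if n: "n \<ge> 1" for n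
  proof -
    have ind: "indep_vars (\<lambda>_. borel) \<epsilon> {1..}" and mv: "\<And>i. i \<in> {1..} \<Longrightarrow> has_mean_variance (\<epsilon> i) 0 v"
      using iid by (auto simp: iid_mean_variance_def)
    have c: "0 < A * sqrt (real n)" using A n by simp
    have sub: "Suc ` {..<n} \<subseteq> {1..}" by auto
    define B where "B = {\<omega> \<in> space M. \<exists>k\<le>n. \<bar>\<Sum>i<k. \<epsilon> (Suc i) \<omega>\<bar> \<ge> A * sqrt (real n)}"
    note kol = kolmogorov_maximal_inequality[OF ind mv inj_Suc[THEN inj_on_subset, OF subset_UNIV] sub c]
    have "prob B \<le> real n * v / (A * sqrt (real n))\<^sup>2" unfolding B_def by (rule kol(2))
    also have "\<dots> = v / (v / p + 1)" using n by (simp add: power_mult_distrib A2)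
    also have "\<dots> < p"
    proof -
      have "v < p * (v / p + 1)" using p by (simp add: distrib_left)
      then show ?thesis using \<open>0 < v / p + 1\<close> by (simp add: pos_divide_less_eq)
    qed
    finally have "prob B < p" .
    moreover have "B \<in> events" unfolding B_def by (rule kol(1))
    moreover have "\<bar>\<Sum>i=1..k. \<epsilon> i \<omega>\<bar> \<le> A * sqrt (real n)" if "\<omega> \<in> space M - B" "k \<le> n" for \<omega> k
    proof -
      have "(\<Sum>i=1..k. \<epsilon> i \<omega>) = (\<Sum>i<k. \<epsilon> (Suc i) \<omega>)"
        by (simp add: sum.atLeast1_atMost_eq)
      then show ?thesis using that unfolding B_def by force
    qed
    ultimately show ?thesis by blast
  qed
  with A show ?thesis by blast
qed

text \<open>
  The threshold \<open>L0\<close> is chosen before the anchors \<open>s j\<close>, because these will be the true change-points and move with \<open>n\<close>.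
\<close>
lemma sums_near_anchors:
  fixes m :: nat
  assumes iid: "iid_mean_variance \<epsilon> {1..} 0 v" and v: "0 \<le> v" and p: "0 < p" and \<eta>: "0 < \<eta>"
  shows "\<exists>L0>0. \<forall>n. \<forall>s. (\<forall>j\<in>{1..m}. s j \<le> n) \<longrightarrow> (\<exists>B\<in>events. prob B < p \<and>
    (\<forall>\<omega>\<in>space M - B. \<forall>j\<in>{1..m}. \<forall>L\<ge>L0.
      (s j + L \<le> n \<longrightarrow> \<bar>\<Sum>i=s j + 1..s j + L. \<epsilon> i \<omega>\<bar> \<le> \<eta> * real L) \<and>
      (L \<le> s j \<longrightarrow> \<bar>\<Sum>i=s j - L + 1..s j. \<epsilon> i \<omega>\<bar> \<le> \<eta> * real L)))"
proof -
  have ind: "indep_vars (\<lambda>_. borel) \<epsilon> {1..}" and mv: "\<And>i. i \<in> {1..} \<Longrightarrow> has_mean_variance (\<epsilon> i) 0 v"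
    using iid by (auto simp: iid_mean_variance_def)
  define b where "b = p / (2 * real (m + 1))"
  have b: "b > 0" using p by (simp add: b_def)
  obtain p0 where p0: "4 * v / \<eta>\<^sup>2 / b < 2 ^ p0"
    using real_arch_pow[of 2] by auto
  have b0: "4 * v / (\<eta>\<^sup>2 * 2 ^ p0) \<le> b"
    using p0 b \<eta> by (simp add: field_simps)
  have "\<exists>B\<in>events. prob B < p \<and>
    (\<forall>\<omega>\<in>space M - B. \<forall>j\<in>{1..m}. \<forall>L\<ge>2 ^ p0.
      (s j + L \<le> n \<longrightarrow> \<bar>\<Sum>i=s j + 1..s j + L. \<epsilon> i \<omega>\<bar> \<le> \<eta> * real L) \<and>
      (L \<le> s j \<longrightarrow> \<bar>\<Sum>i=s j - L + 1..s j. \<epsilon> i \<omega>\<bar> \<le> \<eta> * real L))"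
    if s: "\<forall>j\<in>{1..m}. s j \<le> n" for n and s :: "nat \<Rightarrow> nat"
  proof -
    have "\<exists>B\<in>events. prob B \<le> b \<and>
        (\<forall>\<omega>\<in>space M - B. \<forall>L\<ge>2 ^ p0. s j + L \<le> n \<longrightarrow> \<bar>\<Sum>i=s j + 1..s j + L. \<epsilon> i \<omega>\<bar> \<le> \<eta> * real L)"
      if j: "j \<in> {1..m}" for j
    proof -
      have "inj_on (\<lambda>i. s j + 1 + i) {..<n - s j}" "(\<lambda>i. s j + 1 + i) ` {..<n - s j} \<subseteq> {1..}"
        by (auto simp: inj_on_def)
      from dyadic_deviation_bound[OF ind mv this \<eta> v, of p0]
      obtain B where B: "B \<in> events" "prob B \<le> 4 * v / (\<eta>\<^sup>2 * 2 ^ p0)"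
        "\<And>\<omega> L. \<omega> \<in> space M - B \<Longrightarrow> 2 ^ p0 \<le> L \<Longrightarrow> L \<le> n - s j \<Longrightarrow> \<bar>\<Sum>i<L. \<epsilon> (s j + 1 + i) \<omega>\<bar> \<le> \<eta> * real L"
        by auto
      have shift: "(\<Sum>i=s j + 1..s j + L. \<epsilon> i \<omega>) = (\<Sum>i<L. \<epsilon> (s j + 1 + i) \<omega>)" for L \<omega>
        by (rule sum.reindex_bij_witness[of _ "\<lambda>i. s j + 1 + i" "\<lambda>i. i - (s j + 1)"]) auto
      show ?thesis
        using B b0 by (intro bexI[of _ B]) (auto simp: shift simp del: One_nat_def)
    qed
    then obtain BR where BR: "\<And>j. j \<in> {1..m} \<Longrightarrow> BR j \<in> events" "\<And>j. j \<in> {1..m} \<Longrightarrow> prob (BR j) \<le> b"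
      "\<And>j \<omega> L. j \<in> {1..m} \<Longrightarrow> \<omega> \<in> space M - BR j \<Longrightarrow> 2 ^ p0 \<le> L \<Longrightarrow> s j + L \<le> n \<Longrightarrow>
         \<bar>\<Sum>i=s j + 1..s j + L. \<epsilon> i \<omega>\<bar> \<le> \<eta> * real L"
      by metis
    have "\<exists>B\<in>events. prob B \<le> b \<and>
        (\<forall>\<omega>\<in>space M - B. \<forall>L\<ge>2 ^ p0. L \<le> s j \<longrightarrow> \<bar>\<Sum>i=s j - L + 1..s j. \<epsilon> i \<omega>\<bar> \<le> \<eta> * real L)"
      if j: "j \<in> {1..m}" for j
    proof -
      have "inj_on (\<lambda>i. s j - i) {..<s j}" "(\<lambda>i. s j - i) ` {..<s j} \<subseteq> {1..}"
        by (auto simp: inj_on_def)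
      from dyadic_deviation_bound[OF ind mv this \<eta> v, of p0]
      obtain B where B: "B \<in> events" "prob B \<le> 4 * v / (\<eta>\<^sup>2 * 2 ^ p0)"
        "\<And>\<omega> L. \<omega> \<in> space M - B \<Longrightarrow> 2 ^ p0 \<le> L \<Longrightarrow> L \<le> s j \<Longrightarrow> \<bar>\<Sum>i<L. \<epsilon> (s j - i) \<omega>\<bar> \<le> \<eta> * real L"
        by auto
      have shift: "(\<Sum>i=s j - L + 1..s j. \<epsilon> i \<omega>) = (\<Sum>i<L. \<epsilon> (s j - i) \<omega>)" if "L \<le> s j" for L \<omega>
        by (rule sum.reindex_bij_witness[of _ "\<lambda>i. s j - i" "\<lambda>i. s j - i"]) (use that in auto)
      show ?thesis
      proof (intro bexI[of _ B] conjI ballI allI impI)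
        fix \<omega> L assume "\<omega> \<in> space M - B" "2 ^ p0 \<le> L" "L \<le> s j"
        then show "\<bar>\<Sum>i=s j - L + 1..s j. \<epsilon> i \<omega>\<bar> \<le> \<eta> * real L"
          using B(3) by (simp only: shift)
      qed (use B b0 in auto)
    qed
    then obtain BL where BL: "\<And>j. j \<in> {1..m} \<Longrightarrow> BL j \<in> events" "\<And>j. j \<in> {1..m} \<Longrightarrow> prob (BL j) \<le> b"
      "\<And>j \<omega> L. j \<in> {1..m} \<Longrightarrow> \<omega> \<in> space M - BL j \<Longrightarrow> 2 ^ p0 \<le> L \<Longrightarrow> L \<le> s j \<Longrightarrow>
         \<bar>\<Sum>i=s j - L + 1..s j. \<epsilon> i \<omega>\<bar> \<le> \<eta> * real L"
      by metis
    define B where "B = (\<Union>j\<in>{1..m}. BR j \<union> BL j)"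
    have "prob B \<le> (\<Sum>j=1..m. prob (BR j \<union> BL j))"
      unfolding B_def using BR(1) BL(1) by (intro finite_measure_subadditive_finite) auto
    also have "\<dots> \<le> (\<Sum>j=1..m. 2 * b)"
    proof (rule sum_mono)
      fix j assume j: "j \<in> {1..m}"
      have "prob (BR j \<union> BL j) \<le> prob (BR j) + prob (BL j)"
        by (rule measure_Un_le[OF BR(1)[OF j] BL(1)[OF j]])
      then show "prob (BR j \<union> BL j) \<le> 2 * b" using BR(2)[OF j] BL(2)[OF j] by simp
    qed
    also have "\<dots> < p" using p by (simp add: b_def field_simps)
    finally have "prob B < p" .
    moreover have "B \<in> events" unfolding B_def using BR(1) BL(1) by auto
    ultimately show ?thesis
      using BR(3) BL(3) by (intro bexI[of _ B]) (auto simp: B_def simp del: One_nat_def)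
  qed
  then show ?thesis by (intro exI[of _ "2 ^ p0"]) auto
qed

lemma mean_variance_tight:
  fixes X :: "nat \<Rightarrow> 'a \<Rightarrow> real"
  assumes X: "\<And>n. has_mean_variance (X n) c v" and p: "0 < p"
  shows "\<exists>A. \<forall>n. \<exists>B\<in>events. prob B < p \<and> (\<forall>\<omega>\<in>space M - B. \<bar>X n \<omega>\<bar> \<le> A)"
proof -
  have v: "0 \<le> v" using X[of 0] unfolding has_mean_variance_def
    by (metis variance_positive)
  define a where "a = sqrt (v / p + 1)"
  have pos: "0 < v / p + 1" using v p by (simp add: add_nonneg_pos)
  then have a: "0 < a" "a\<^sup>2 = v / p + 1" by (auto simp: a_def)
  have "\<exists>B\<in>events. prob B < p \<and> (\<forall>\<omega>\<in>space M - B. \<bar>X n \<omega>\<bar> \<le> \<bar>c\<bar> + a)" for n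
  proof -
    have X': "X n \<in> borel_measurable M" "integrable M (\<lambda>\<omega>. (X n \<omega>)\<^sup>2)" "expectation (X n) = c" "variance (X n) = v"
      using X[of n] unfolding has_mean_variance_def by blast+
    define B where "B = {\<omega> \<in> space M. a \<le> \<bar>X n \<omega> - c\<bar>}"
    have "prob B \<le> v / a\<^sup>2"
      using Chebyshev_inequality[OF X'(1,2) a(1)] X'(3,4) by (simp add: B_def)
    also have "\<dots> < p"
    proof -
      have "v < p * (v / p + 1)" using p by (simp add: distrib_left)
      then show ?thesis using pos by (simp add: pos_divide_less_eq a(2))
    qed
    finally have "prob B < p" .
    moreover have "B \<in> events" unfolding B_def using X'(1) by measurable
    moreover have "\<bar>X n \<omega>\<bar> \<le> \<bar>c\<bar> + a" if "\<omega> \<in> space M - B" for \<omega>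
      using that by (auto simp: B_def)
    ultimately show ?thesis by blast
  qed
  then show ?thesis by blast
qed

text \<open>
  A measurable superset \<open>B\<close> of the event in the definition suffices. All estimates in the theorem hold simultaneously
  outside one such event.
\<close>
lemma big_OP_I:
  assumes "\<And>p. 0 < p \<Longrightarrow> \<exists>C>0. \<forall>\<^sub>F n in sequentially. \<exists>B\<in>events. prob B < p \<and>
    (\<forall>\<omega>\<in>space M - B. \<bar>X n \<omega>\<bar> \<le> C * a n)"
  shows "big_OP X a"
  unfolding big_OP_def
proof (intro allI impI)
  fix p :: real assume "0 < p"
  then obtain C where C: "C > 0" "\<forall>\<^sub>F n in sequentially. \<exists>B\<in>events. prob B < p \<and>
    (\<forall>\<omega>\<in>space M - B. \<bar>X n \<omega>\<bar> \<le> C * a n)" using assms by blast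
  have "\<forall>\<^sub>F n in sequentially. prob {\<omega> \<in> space M. \<bar>X n \<omega>\<bar> > C * a n} < p"
    using C(2)
  proof eventually_elim
    case (elim n)
    then obtain B where B: "B \<in> events" "prob B < p" "\<And>\<omega>. \<omega> \<in> space M - B \<Longrightarrow> \<bar>X n \<omega>\<bar> \<le> C * a n" by auto
    have "{\<omega> \<in> space M. \<bar>X n \<omega>\<bar> > C * a n} \<subseteq> B" using B(3) by force
    then have "prob {\<omega> \<in> space M. \<bar>X n \<omega>\<bar> > C * a n} \<le> prob B"
      using B(1) by (rule finite_measure_mono)
    then show ?case using B(2) by simp
  qed
  then show "\<exists>C>0. \<forall>\<^sub>F n in sequentially. prob {\<omega> \<in> space M. \<bar>X n \<omega>\<bar> > C * a n} < p"
    using C(1) by blast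
qed

end

section \<open>Rates for the change-points and levels\<close>

lemma change_index_near:
  assumes "0 \<le> \<tau> k"
  shows "real (change_index \<tau> n k) \<le> real n * \<tau> k" "real n * \<tau> k < real (change_index \<tau> n k) + 1"
  using assms by (simp_all add: change_index_def)

lemma finite_positive_lower_bound:
  fixes f :: "nat \<Rightarrow> real"
  assumes "\<And>k. k \<in> {1..m} \<Longrightarrow> 0 < f k"
  shows "\<exists>c>0. \<forall>k\<in>{1..m}. c \<le> f k"
proof (intro exI conjI ballI)
  let ?F = "insert 1 (f ` {1..m})"
  show "0 < Min ?F" using assms by (subst Min_gr_iff) auto
  show "Min ?F \<le> f k" if "k \<in> {1..m}" for k using that by (intro Min_le) auto
qed

theorem proposition2:
  fixes M :: "'a measure"
    and m :: nat
    and \<tau> \<mu> \<delta> :: "nat \<Rightarrow> real"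
    and \<rho> \<sigma> \<alpha> :: real
    and \<epsilon> :: "nat \<Rightarrow> 'a \<Rightarrow> real"
    and z :: "nat \<Rightarrow> nat \<Rightarrow> 'a \<Rightarrow> real"
    and \<rho>bar :: "nat \<Rightarrow> 'a \<Rightarrow> real"
    and \<Delta> :: "nat \<Rightarrow> real"
    and \<delta>hat :: "nat \<Rightarrow> 'a \<Rightarrow> nat \<Rightarrow> real"
    and that :: "nat \<Rightarrow> 'a \<Rightarrow> nat \<Rightarrow> nat"
  assumes "prob_space M"
    and "\<tau> 0 = 0" and "\<tau> (m + 1) = 1" and "\<And>k. k \<le> m \<Longrightarrow> \<tau> k < \<tau> (k + 1)"
    and "\<And>k. 1 \<le> k \<Longrightarrow> k \<le> m \<Longrightarrow> \<mu> k \<noteq> \<mu> (k - 1)"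
    and "\<bar>\<rho>\<bar> < 1" and "\<sigma> > 0"
    and "\<And>k. k \<le> m \<Longrightarrow> \<delta> k = (1 - \<rho>) * \<mu> k"
    and "prob_space.iid_mean_variance M \<epsilon> {1..} 0 (\<sigma>\<^sup>2)"
    and "\<And>n. prob_space.has_mean_variance M (z n 0) (\<mu> 0) (\<sigma>\<^sup>2 / (1 - \<rho>\<^sup>2))"
    and "\<And>n. distr M borel (z n 0) = distr M borel (z 0 0)"
    and "\<And>n. prob_space.indep_rv M borel (z n 0)
               (\<Pi>\<^sub>M i\<in>{1..}. borel) (\<lambda>\<omega>. \<lambda>i\<in>{1..}. \<epsilon> i \<omega>)"
    and "\<And>n k i \<omega>. k \<le> m \<Longrightarrow> i \<in> {change_index \<tau> n k + 1..change_index \<tau> n (k + 1)} \<Longrightarrow>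
               \<omega> \<in> space M \<Longrightarrow>
               z n i \<omega> - \<mu> k = \<rho> * (z n (i - 1) \<omega> - \<mu> k) + \<epsilon> i \<omega>"
    and "\<And>n. \<rho>bar n \<in> borel_measurable M"
    and "prob_space.big_OP M (\<lambda>n \<omega>. \<rho>bar n \<omega> - \<rho>) (\<lambda>n. real n powr (- (1/2)))"
    and "(\<lambda>n. \<Delta> n / real n) \<longlonglongrightarrow> 0"
    and "\<alpha> > 0" and "filterlim (\<lambda>n. real n powr (- \<alpha>) * \<Delta> n) at_top sequentially"
    and "\<And>n k. admissible \<Delta> n m \<noteq> {} \<Longrightarrow> k \<le> m \<Longrightarrow>
               (\<lambda>\<omega>. \<delta>hat n \<omega> k) \<in> borel_measurable M"
    and "\<And>n k. admissible \<Delta> n m \<noteq> {} \<Longrightarrow> k \<le> m + 1 \<Longrightarrow>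
               (\<lambda>\<omega>. that n \<omega> k) \<in> measurable M (count_space UNIV)"
    and "\<And>n \<omega>. admissible \<Delta> n m \<noteq> {} \<Longrightarrow> \<omega> \<in> space M \<Longrightarrow>
               is_arg_min (\<lambda>(d, t). SS m (\<lambda>i. z n i \<omega>) (\<rho>bar n \<omega>) d t)
                 (\<lambda>(d, t). t \<in> admissible \<Delta> n m) (\<delta>hat n \<omega>, that n \<omega>)"
  shows "prob_space.big_OP M
           (\<lambda>n \<omega>. L2_set (\<lambda>k. real (that n \<omega> k) / real n - \<tau> k) {0..m + 1})
           (\<lambda>n. 1 / real n)
       \<and> prob_space.big_OP M
           (\<lambda>n \<omega>. L2_set (\<lambda>k. \<delta>hat n \<omega> k - \<delta> k) {0..m})
           (\<lambda>n. real n powr (- (1/2)))"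
proof -
  interpret prob_space M by fact
  note \<tau>0 = assms(2) and \<tau>1 = assms(3) and \<tau>_less = assms(4) and \<mu>_neq = assms(5) and \<rho> = assms(6)
    and \<sigma> = assms(7) and \<delta> = assms(8) and iid = assms(9) and z0 = assms(10) and model = assms(13)
    and \<rho>bar_meas = assms(14) and \<rho>bar = assms(15) and \<Delta>_small = assms(16) and \<alpha> = assms(17)
    and \<Delta>_large = assms(18) and argmin = assms(21)
  define s where "s n = change_index \<tau> n" for n
  have \<tau>_mono: "\<tau> j \<le> \<tau> k" if "j \<le> k" "k \<le> m + 1" for j k
    using that
  proof (induction k rule: dec_induct)
    case (step k)
    then show ?case using \<tau>_less[of k] by simp
  qed simp
  have \<tau>_nonneg: "0 \<le> \<tau> k" if "k \<le> m + 1" for k using \<tau>_mono[of 0 k] that \<tau>0 by simp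
  note s_near = change_index_near[where \<tau> = \<tau>, OF \<tau>_nonneg, folded s_def]
  have s0: "s n 0 = 0" and s1: "s n (m + 1) = n" for n
    using \<tau>0 \<tau>1 by (simp_all add: s_def change_index_def)
  obtain c where c: "0 < c" "\<And>k. k \<le> m \<Longrightarrow> 4 * c \<le> \<tau> (k + 1) - \<tau> k"
  proof -
    have "\<exists>c>0. \<forall>k\<in>{1..m + 1}. c \<le> \<tau> k - \<tau> (k - 1)"
    proof (rule finite_positive_lower_bound)
      show "0 < \<tau> k - \<tau> (k - 1)" if "k \<in> {1..m + 1}" for k
        using \<tau>_less[of "k - 1"] that by (cases k) auto
    qed
    then obtain c where "c > 0" "\<forall>k\<in>{1..m + 1}. c \<le> \<tau> k - \<tau> (k - 1)" by blast
    then show ?thesis by (intro that[of "c / 4"]) force+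
  qed
  obtain J where J: "0 < J" "\<And>k. k \<in> {1..m} \<Longrightarrow> J \<le> \<bar>\<delta> k - \<delta> (k - 1)\<bar>"
  proof -
    have "\<delta> k - \<delta> (k - 1) = (1 - \<rho>) * (\<mu> k - \<mu> (k - 1))" if "k \<in> {1..m}" for k
    proof -
      have "k \<le> m" "k - 1 \<le> m" using that by auto
      then show ?thesis by (simp only: \<delta> right_diff_distrib)
    qed
    then have "\<exists>J>0. \<forall>k\<in>{1..m}. J \<le> \<bar>\<delta> k - \<delta> (k - 1)\<bar>"
      using \<mu>_neq \<rho> by (intro finite_positive_lower_bound) auto
    then show ?thesis using that by blast
  qed
  define D where "D = (\<Sum>k\<le>m. \<bar>\<delta> k\<bar>)"
  have D: "\<bar>\<delta> k\<bar> \<le> D" if "k \<le> m" for k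
    unfolding D_def using that by (intro member_le_sum[of k "{..m}" "\<lambda>k. \<bar>\<delta> k\<bar>"]) auto
  \<comment> \<open>True segments have length at least \<open>4 c n - 1\<close>, which leaves room for \<open>3 w n\<close> after rounding.\<close>
  define w where "w n = nat \<lfloor>c * real n\<rfloor>" for n
  have w: "real (w n) \<le> c * real n" "c * real n < real (w n) + 1" for n
    using c(1) by (simp_all add: w_def)

  have \<Delta>_top: "filterlim \<Delta> at_top sequentially"
  proof (rule filterlim_at_top_mono[OF \<Delta>_large])
    show "\<forall>\<^sub>F n in sequentially. real n powr (- \<alpha>) * \<Delta> n \<le> \<Delta> n"
      using eventually_ge_at_top[of 1] filterlim_at_top_dense[THEN iffD1, OF \<Delta>_large, rule_format, of 0]
    proof eventually_elim
      case (elim n)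
      then have "0 < \<Delta> n" by (simp add: zero_less_mult_iff)
      moreover have "real n powr (- \<alpha>) \<le> 1"
        using elim \<alpha> powr_mono[of "- \<alpha>" 0 "real n"] by simp
      ultimately show ?case by (simp add: mult_le_cancel_right1)
    qed
  qed
  have n_top: "filterlim (\<lambda>n. real n) at_top sequentially" by (rule filterlim_real_sequentially)
  have sqrt_top: "filterlim (\<lambda>n. sqrt (real n)) at_top sequentially"
    by (rule filterlim_compose[OF sqrt_at_top n_top])
  have ev_n: "\<forall>\<^sub>F n in sequentially. b \<le> real n" for b
    using n_top unfolding filterlim_at_top by blast
  have ev_sqrt: "\<forall>\<^sub>F n in sequentially. b \<le> sqrt (real n)" for b
    using sqrt_top unfolding filterlim_at_top by blast
  have ev_\<Delta>: "\<forall>\<^sub>F n in sequentially. b \<le> \<Delta> n" for b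
    using \<Delta>_top unfolding filterlim_at_top by blast

  have ev_ratio: "\<forall>\<^sub>F n in sequentially. \<Delta> n / real n < c / 2"
    using c(1) by (intro order_tendstoD(2)[OF \<Delta>_small]) simp

  have geometry: "\<forall>\<^sub>F n in sequentially. 1 \<le> n \<and> c / 2 * real n \<le> real (w n) \<and> 0 < \<Delta> n \<and> \<Delta> n \<le> real (w n) \<and>
      segmentation m n (s n) \<and> (\<forall>k\<le>m. s n k + 3 * w n \<le> s n (k + 1))"
    using ev_n[of "2 / c"] ev_n[of 1] ev_\<Delta>[of 1] ev_ratio
  proof eventually_elim
    case (elim n)
    then have cn: "2 \<le> c * real n" using c(1) by (simp add: field_simps)
    have w2: "c / 2 * real n \<le> real (w n)" using w(2)[of n] cn by linarith
    have gap: "s n k + 3 * w n \<le> s n (k + 1)" if k: "k \<le> m" for k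
    proof -
      have "4 * c * real n \<le> (\<tau> (k + 1) - \<tau> k) * real n"
        using c(2)[OF k] by (intro mult_right_mono) auto
      then have "real (s n k + 3 * w n) \<le> real (s n (k + 1))"
        using s_near(1)[of k n] s_near(2)[of "k + 1" n] k w(1)[of n] cn by (simp add: algebra_simps)
      then show ?thesis by (simp only: of_nat_le_iff)
    qed
    have "0 < w n" using w2 cn by (cases "w n = 0") auto
    then have "s n k < s n (k + 1)" if "k \<le> m" for k using gap[OF that] by linarith
    then have "segmentation m n (s n)" using s0 s1 by (simp add: segmentation_def)
    moreover have "\<Delta> n \<le> real (w n)" using elim w2 by (simp add: field_simps)
    ultimately show ?case using elim w2 gap by auto
  qed

  \<comment> \<open>Both rates hold outside one and the same exceptional event, so they are proved together.\<close>
  have main: "\<exists>L C. 0 \<le> L \<and> 0 \<le> C \<and> (\<forall>\<^sub>F n in sequentially. \<exists>B\<in>events. prob B < p \<and> (\<forall>\<omega>\<in>space M - B.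
      (\<forall>k\<le>m + 1. \<bar>real (that n \<omega> k) - real (s n k)\<bar> \<le> L) \<and>
      (\<forall>k\<le>m. \<bar>\<delta>hat n \<omega> k - \<delta> k\<bar> \<le> C / sqrt (real n))))" if p: "0 < p" for p
  proof -
    have p4: "0 < p / 4" using p by simp
    obtain C where C: "C > 0" and C_ev: "\<forall>\<^sub>F n in sequentially.
        prob {\<omega> \<in> space M. \<bar>\<rho>bar n \<omega> - \<rho>\<bar> > C * real n powr (- (1/2))} < p / 4"
      using \<rho>bar p4 unfolding big_OP_def by blast
    obtain A0 where A0: "\<And>n. \<exists>B\<in>events. prob B < p / 4 \<and> (\<forall>\<omega>\<in>space M - B. \<bar>z n 0 \<omega>\<bar> \<le> A0)"
      using mean_variance_tight[of "\<lambda>n. z n 0", OF z0 p4] by blast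
    obtain A where A: "A > 0" "\<And>n. n \<ge> 1 \<Longrightarrow> \<exists>B\<in>events. prob B < p / 4 \<and>
        (\<forall>\<omega>\<in>space M - B. \<forall>k\<le>n. \<bar>\<Sum>i=1..k. \<epsilon> i \<omega>\<bar> \<le> A * sqrt (real n))"
      using partial_sums_tight[OF iid _ p4] by auto
    define Z where "Z = A0 + (D + 2 * A) / (1 - \<bar>\<rho>\<bar>)"
    define q where "q = C / (1 - \<rho>)"
    define R where "R = (1 + q) * A + q * (D + 2 * Z)"
    \<comment> \<open>The constants are fixed in the order forced by \<open>estimates_on_good_event\<close>: \<open>C\<close>, \<open>A0\<close>, \<open>A\<close> from tightness, then the
        slope \<open>\<eta>\<close>, then \<open>L0\<close>, which also has to dominate the boundary terms of \<open>perturbed_noise_sum\<close>. Only then is \<open>n\<close>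
        taken large.\<close>
    define \<eta> where "\<eta> = J / 24 / (1 + q)"
    have q0: "0 \<le> q" using C \<rho> by (simp add: q_def)
    have \<eta>: "0 < \<eta>" "(1 + q) * \<eta> \<le> J / 24" 
    proof -
      have "1 + q \<noteq> 0" using q0 by linarith
      then show "(1 + q) * \<eta> \<le> J / 24"
        unfolding \<eta>_def times_divide_eq_right [of "1 + q" "J / 24"] by (subst nonzero_mult_div_cancel_left) auto
      show "0 < \<eta>" using J(1) q0 by (simp add: \<eta>_def)
    qed
    obtain L1 where L1: "L1 > 0" "\<And>n s. \<forall>j\<in>{1..m}. s j \<le> n \<Longrightarrow> \<exists>B\<in>events. prob B < p / 4 \<and>
        (\<forall>\<omega>\<in>space M - B. \<forall>j\<in>{1..m}. \<forall>L\<ge>L1.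
          (s j + L \<le> n \<longrightarrow> \<bar>\<Sum>i=s j + 1..s j + L. \<epsilon> i \<omega>\<bar> \<le> \<eta> * real L) \<and>
          (L \<le> s j \<longrightarrow> \<bar>\<Sum>i=s j - L + 1..s j. \<epsilon> i \<omega>\<bar> \<le> \<eta> * real L))"
      using sums_near_anchors[OF iid _ p4 \<eta>(1), of m] by auto
    define L0 where "L0 = max L1 (nat \<lceil>48 * q * Z / J\<rceil>)"
    have L0: "L0 > 0" "L1 \<le> L0" using L1(1) by (auto simp: L0_def)
    have qZ: "2 * q * Z \<le> J / 24 * real L0"
    proof -
      have "48 * q * Z / J \<le> real L0" unfolding L0_def by linarith
      then show ?thesis using J(1) by (simp add: field_simps)
    qed
    define K1 K2 where "K1 = 16 * real (m + 1) * R * D" and "K2 = 16 * (real (m + 1) * R)\<^sup>2"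
    define g where "g = c / 4 * (J / 8)\<^sup>2"
    have g: "0 < g" using c(1) J(1) by (simp add: g_def)
    define C' where "C' = \<bar>2 / c * (8 * real L0 * D + 4 * R)\<bar>"
    have "\<forall>\<^sub>F n in sequentially. \<exists>B\<in>events. prob B < p \<and> (\<forall>\<omega>\<in>space M - B.
      (\<forall>k\<le>m + 1. \<bar>real (that n \<omega> k) - real (s n k)\<bar> \<le> real L0) \<and>
      (\<forall>k\<le>m. \<bar>\<delta>hat n \<omega> k - \<delta> k\<bar> \<le> C' / sqrt (real n)))"
      using geometry C_ev ev_sqrt[of "q * D * 24 / J"] ev_sqrt[of "K1 / g"] ev_\<Delta>[of "K2 / g"]
    proof eventually_elim
      case (elim n)
      then have geo: "1 \<le> n" "c / 2 * real n \<le> real (w n)" "0 < \<Delta> n" "\<Delta> n \<le> real (w n)"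
        "segmentation m n (s n)" "\<And>k. k \<le> m \<Longrightarrow> s n k + 3 * w n \<le> s n (k + 1)" by auto
      define N where "N = sqrt (real n)"
      have N: "1 \<le> N" "N * N = real n" using geo(1) by (auto simp: N_def)
      have powr_N: "real n powr (- (1/2)) = 1 / N"
        using geo(1) by (simp add: N_def powr_minus powr_half_sqrt field_simps)
      have qD: "q * D \<le> J / 24 * N" using elim J(1) by (simp add: N_def field_simps)
      have small: "16 * real (m + 1) * (R * N) * D + 16 * (real (m + 1) * (R * N))\<^sup>2 / \<Delta> n \<le> real (w n) * (J / 8)\<^sup>2"
      proof -
        have "K1 \<le> g * N" using elim g by (simp add: N_def field_simps)
        then have 1: "K1 * N \<le> g * N * N" using N(1) by (intro mult_right_mono) auto
        have "K2 / \<Delta> n \<le> g" using elim g geo(3) by (simp add: field_simps)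
        then have 2: "K2 / \<Delta> n * real n \<le> g * real n" by (intro mult_right_mono) auto
        have "16 * real (m + 1) * (R * N) * D + 16 * (real (m + 1) * (R * N))\<^sup>2 / \<Delta> n
            = K1 * N + K2 / \<Delta> n * (N * N)"
          by (simp add: K1_def K2_def power_mult_distrib power2_eq_square)
        also have "\<dots> \<le> g * real n + g * real n" using 1 2 N(2) by (simp add: mult.assoc)
        also have "\<dots> = (c / 2 * real n) * (J / 8)\<^sup>2" by (simp add: g_def)
        also have "\<dots> \<le> real (w n) * (J / 8)\<^sup>2" using geo(2) by (intro mult_right_mono) auto
        finally show ?thesis .
      qed
      obtain B1 where B1: "B1 \<in> events" "prob B1 < p / 4" "\<And>\<omega>. \<omega> \<in> space M - B1 \<Longrightarrow> \<bar>\<rho>bar n \<omega> - \<rho>\<bar> \<le> C / N"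
      proof (rule that[of "{\<omega> \<in> space M. \<bar>\<rho>bar n \<omega> - \<rho>\<bar> > C * real n powr (- (1/2))}"])
        show "{\<omega> \<in> space M. \<bar>\<rho>bar n \<omega> - \<rho>\<bar> > C * real n powr (- (1/2))} \<in> events"
          using \<rho>bar_meas[of n] by measurable
      qed (use elim powr_N in auto)
      obtain B2 where B2: "B2 \<in> events" "prob B2 < p / 4" "\<And>\<omega>. \<omega> \<in> space M - B2 \<Longrightarrow> \<bar>z n 0 \<omega>\<bar> \<le> A0"
        using A0[of n] by blast
      obtain B3 where B3: "B3 \<in> events" "prob B3 < p / 4"
        "\<And>\<omega> k. \<omega> \<in> space M - B3 \<Longrightarrow> k \<le> n \<Longrightarrow> \<bar>\<Sum>i=1..k. \<epsilon> i \<omega>\<bar> \<le> A * N"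
        using A(2)[OF geo(1)] unfolding N_def by blast
      have "\<forall>j\<in>{1..m}. s n j \<le> n" using segmentation_le[OF geo(5)] by auto
      from L1(2)[OF this] obtain B4 where B4: "B4 \<in> events" "prob B4 < p / 4"
        and B4_right: "\<And>\<omega> j L. \<omega> \<in> space M - B4 \<Longrightarrow> j \<in> {1..m} \<Longrightarrow> L1 \<le> L \<Longrightarrow> s n j + L \<le> n \<Longrightarrow>
          \<bar>\<Sum>i=s n j + 1..s n j + L. \<epsilon> i \<omega>\<bar> \<le> \<eta> * real L"
        and B4_left: "\<And>\<omega> j L. \<omega> \<in> space M - B4 \<Longrightarrow> j \<in> {1..m} \<Longrightarrow> L1 \<le> L \<Longrightarrow> L \<le> s n j \<Longrightarrow>
          \<bar>\<Sum>i=s n j - L + 1..s n j. \<epsilon> i \<omega>\<bar> \<le> \<eta> * real L"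
        by blast
      define B where "B = (B1 \<union> B2) \<union> (B3 \<union> B4)"
      have "prob B < p"
        using measure_Un_le[of "B1 \<union> B2" M "B3 \<union> B4"] measure_Un_le[of B1 M B2] measure_Un_le[of B3 M B4]
          B1(1,2) B2(1,2) B3(1,2) B4 unfolding B_def by auto
      moreover have "B \<in> events" using B1 B2 B3 B4 by (auto simp: B_def)
      moreover have "(\<forall>k\<le>m + 1. \<bar>real (that n \<omega> k) - real (s n k)\<bar> \<le> real L0) \<and>
          (\<forall>k\<le>m. \<bar>\<delta>hat n \<omega> k - \<delta> k\<bar> \<le> C' / sqrt (real n))" if \<omega>: "\<omega> \<in> space M - B" for \<omega>
      proof -
        have \<omega>B: "\<omega> \<in> space M" "\<omega> \<in> space M - B1" "\<omega> \<in> space M - B2" "\<omega> \<in> space M - B3" "\<omega> \<in> space M - B4"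
          using \<omega> by (auto simp: B_def)
        have rec: "z n i \<omega> = \<rho> * z n (i - 1) \<omega> + \<delta> k + \<epsilon> i \<omega>"
          if "k \<le> m" "s n k < i" "i \<le> s n (k + 1)" for k i
          using model[OF that(1), of i n \<omega>] that \<omega>B(1) \<delta>[OF that(1)] by (simp add: s_def algebra_simps)
        have gap\<Delta>: "\<Delta> n \<le> real (s n (k + 1)) - real (s n k)" if "k \<le> m" for k
        proof -
          have "real (s n k + 3 * w n) \<le> real (s n (k + 1))" using geo(6)[OF that] by (simp only: of_nat_le_iff)
          then show ?thesis using geo(4) by simp
        qed
        then have "s n \<in> admissible \<Delta> n m" using geo(5) by (simp add: admissible_iff)
        then have opt: "is_arg_min (\<lambda>(d, t). SS m (\<lambda>i. z n i \<omega>) (\<rho>bar n \<omega>) d t)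
            (\<lambda>(d, t). t \<in> admissible \<Delta> n m) (\<delta>hat n \<omega>, that n \<omega>)"
          using argmin[of n \<omega>] \<omega>B(1) by blast
        note est = estimates_on_good_event[of m n "s n" "\<lambda>i. z n i \<omega>" \<rho> \<delta>
            "\<lambda>i. \<epsilon> i \<omega>" "w n" J D "\<rho>bar n \<omega>" C A0 A L0 \<eta> \<Delta>,
          folded Z_def q_def, folded R_def N_def,
          OF geo(5) rec geo(6) J(2,1) D \<rho> geo(1) B1(3)[OF \<omega>B(2)] B2(3)[OF \<omega>B(3)] B3(3)[OF \<omega>B(4)]
            B4_right[OF \<omega>B(5) _ order_trans[OF L0(2)]] B4_left[OF \<omega>B(5) _ order_trans[OF L0(2)]]
            L0(1) \<eta>(2) qD qZ geo(3,4) small opt]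
        have "\<bar>real (that n \<omega> k) - real (s n k)\<bar> \<le> real L0" if k: "k \<le> m + 1" for k
        proof -
          have "that n \<omega> k < s n k + L0 \<and> s n k < that n \<omega> k + L0"
            using k by - (rule est(1); assumption)
          then show ?thesis by linarith
        qed
        moreover have "\<bar>\<delta>hat n \<omega> k - \<delta> k\<bar> \<le> C' / N" if k: "k \<le> m" for k
        proof -
          have D0: "0 \<le> D" using D[of 0] by simp
          have "c / 2 * (N * N) * \<bar>\<delta>hat n \<omega> k - \<delta> k\<bar> \<le> real (w n) * \<bar>\<delta>hat n \<omega> k - \<delta> k\<bar>"
            using geo(2) unfolding N(2) by (intro mult_right_mono) auto
          also have "\<dots> \<le> 8 * real L0 * D + 4 * (R * N)"
            using k by - (rule est(2); assumption)
          also have "\<dots> \<le> 8 * real L0 * D * N + 4 * (R * N)"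
            using mult_left_mono[OF N(1), of "8 * real L0 * D"] D0 by simp
          also have "\<dots> = c / 2 * (2 / c * (8 * real L0 * D + 4 * R)) * N" using c(1) by (simp add: field_simps)
          also have "\<dots> \<le> c / 2 * C' * N"
            using c(1) N(1) unfolding C'_def by (intro mult_right_mono mult_left_mono abs_ge_self) auto
          finally have "(c / 2 * N) * (N * \<bar>\<delta>hat n \<omega> k - \<delta> k\<bar>) \<le> (c / 2 * N) * C'" by (simp add: mult_ac)
          then have "N * \<bar>\<delta>hat n \<omega> k - \<delta> k\<bar> \<le> C'"
            using c(1) N(1) by (subst (asm) mult_le_cancel_left_pos) auto
          then show ?thesis using N(1) by (simp add: field_simps)
        qed
        ultimately show ?thesis by (simp add: N_def)
      qed
      ultimately show ?case by blast
    qed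
    then show ?thesis by (intro exI[of _ "real L0"] exI[of _ C']) (auto simp: C'_def)
  qed

  show ?thesis
  proof
    show "big_OP (\<lambda>n \<omega>. L2_set (\<lambda>k. real (that n \<omega> k) / real n - \<tau> k) {0..m + 1}) (\<lambda>n. 1 / real n)"
    proof (rule big_OP_I)
      fix p :: real assume "0 < p"
      from main[OF this] obtain L C where L: "0 \<le> L" and C: "0 \<le> C" and
        ev: "\<forall>\<^sub>F n in sequentially. \<exists>B\<in>events. prob B < p \<and> (\<forall>\<omega>\<in>space M - B.
          (\<forall>k\<le>m + 1. \<bar>real (that n \<omega> k) - real (s n k)\<bar> \<le> L) \<and>
          (\<forall>k\<le>m. \<bar>\<delta>hat n \<omega> k - \<delta> k\<bar> \<le> C / sqrt (real n)))"
        by blast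
      have "\<forall>\<^sub>F n in sequentially. \<exists>B\<in>events. prob B < p \<and> (\<forall>\<omega>\<in>space M - B.
          \<bar>L2_set (\<lambda>k. real (that n \<omega> k) / real n - \<tau> k) {0..m + 1}\<bar> \<le> real (m + 2) * (L + 1) * (1 / real n))"
        using ev eventually_ge_at_top[of 1]
      proof eventually_elim
        case (elim n)
        have "\<bar>L2_set (\<lambda>k. real (that n \<omega> k) / real n - \<tau> k) {0..m + 1}\<bar> \<le> real (m + 2) * (L + 1) * (1 / real n)"
          if h: "\<forall>k\<le>m + 1. \<bar>real (that n \<omega> k) - real (s n k)\<bar> \<le> L" for \<omega>
        proof -
          have "\<bar>real (that n \<omega> k) / real n - \<tau> k\<bar> \<le> (L + 1) / real n" if k: "k \<in> {0..m + 1}" for k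
          proof -
            have "\<bar>real (that n \<omega> k) - real n * \<tau> k\<bar> \<le> L + 1"
              using h[rule_format, of k] s_near[of k n] k by fastforce
            moreover have "real (that n \<omega> k) / real n - \<tau> k = (real (that n \<omega> k) - real n * \<tau> k) / real n"
              using elim by (simp add: field_simps)
            ultimately show ?thesis using elim by (simp add: divide_right_mono)
          qed
          then have "(\<Sum>k=0..m + 1. \<bar>real (that n \<omega> k) / real n - \<tau> k\<bar>) \<le> (\<Sum>k=0..m + 1. (L + 1) / real n)"
            by (rule sum_mono)
          then show ?thesis
            using L2_set_le_sum_abs[of "\<lambda>k. real (that n \<omega> k) / real n - \<tau> k" "{0..m + 1}"] by simp
        qed
        then show ?case using elim(1) by (elim bexE conjE) (intro bexI conjI ballI; blast)
      qed
      moreover have "0 < real (m + 2) * (L + 1)" using L by simp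
      ultimately show "\<exists>C>0. \<forall>\<^sub>F n in sequentially. \<exists>B\<in>events. prob B < p \<and> (\<forall>\<omega>\<in>space M - B.
          \<bar>L2_set (\<lambda>k. real (that n \<omega> k) / real n - \<tau> k) {0..m + 1}\<bar> \<le> C * (1 / real n))"
        by blast
    qed
    show "big_OP (\<lambda>n \<omega>. L2_set (\<lambda>k. \<delta>hat n \<omega> k - \<delta> k) {0..m}) (\<lambda>n. real n powr (- (1/2)))"
    proof (rule big_OP_I)
      fix p :: real assume "0 < p"
      from main[OF this] obtain L C where L: "0 \<le> L" and C: "0 \<le> C" and
        ev: "\<forall>\<^sub>F n in sequentially. \<exists>B\<in>events. prob B < p \<and> (\<forall>\<omega>\<in>space M - B.
          (\<forall>k\<le>m + 1. \<bar>real (that n \<omega> k) - real (s n k)\<bar> \<le> L) \<and>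
          (\<forall>k\<le>m. \<bar>\<delta>hat n \<omega> k - \<delta> k\<bar> \<le> C / sqrt (real n)))"
        by blast
      have "\<forall>\<^sub>F n in sequentially. \<exists>B\<in>events. prob B < p \<and> (\<forall>\<omega>\<in>space M - B.
          \<bar>L2_set (\<lambda>k. \<delta>hat n \<omega> k - \<delta> k) {0..m}\<bar> \<le> real (m + 1) * (C + 1) * real n powr (- (1/2)))"
        using ev eventually_ge_at_top[of 1]
      proof eventually_elim
        case (elim n)
        have "\<bar>L2_set (\<lambda>k. \<delta>hat n \<omega> k - \<delta> k) {0..m}\<bar> \<le> real (m + 1) * (C + 1) * real n powr (- (1/2))"
          if h: "\<forall>k\<le>m. \<bar>\<delta>hat n \<omega> k - \<delta> k\<bar> \<le> C / sqrt (real n)" for \<omega>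
        proof -
          have "(\<Sum>k=0..m. \<bar>\<delta>hat n \<omega> k - \<delta> k\<bar>) \<le> (\<Sum>k=0..m. (C + 1) / sqrt (real n))"
          proof (rule sum_mono)
            fix k assume "k \<in> {0..m}"
            then have "\<bar>\<delta>hat n \<omega> k - \<delta> k\<bar> \<le> C / sqrt (real n)" using h by auto
            also have "\<dots> \<le> (C + 1) / sqrt (real n)" by (intro divide_right_mono) auto
            finally show "\<bar>\<delta>hat n \<omega> k - \<delta> k\<bar> \<le> (C + 1) / sqrt (real n)" .
          qed
          moreover have "real n powr (- (1/2)) = 1 / sqrt (real n)"
            using elim by (simp add: powr_minus powr_half_sqrt field_simps)
          ultimately show ?thesis
            using L2_set_le_sum_abs[of "\<lambda>k. \<delta>hat n \<omega> k - \<delta> k" "{0..m}"] by simp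
        qed
        then show ?case using elim(1) by (elim bexE conjE) (intro bexI conjI ballI; blast)
      qed
      moreover have "0 < real (m + 1) * (C + 1)" using C by simp
      ultimately show "\<exists>C>0. \<forall>\<^sub>F n in sequentially. \<exists>B\<in>events. prob B < p \<and> (\<forall>\<omega>\<in>space M - B.
          \<bar>L2_set (\<lambda>k. \<delta>hat n \<omega> k - \<delta> k) {0..m}\<bar> \<le> C * real n powr (- (1/2)))"
        by blast
    qed
  qed
qed

end
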